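(* Any optimal trajectory $v^*\in V$ is constituted solely of some combination of finitely many segments, each of which is an EL phase, an $\alpha$ phase, a $\beta$ phase, a $v_{\max}$ phase or a $0$ phase. In fact, the phases of positive velocity must occur in one of the following seventeen orders, where the cases marked ( * ) are those that cannot occur if the Euler--Lagrange curves never have slope less than $-\beta$ while they are positive: - $\alpha$; $\ \alpha\leadsto\beta$ ( * ); $\ \alpha\leadsto EL\leadsto\beta$ ( * ); $\ \alpha\leadsto v_{\max}\leadsto EL\leadsto\beta$ ( * ); $\ \alpha\leadsto EL$; $\ \alpha\leadsto v_{\max}\leadsto EL$; $\ \alpha\leadsto v_{\max}\leadsto\beta$ ( * ); $\ \alpha\leadsto v_{\max}$; - $\beta$; $\ \beta\leadsto EL\leadsto\beta$ ( * ); $\ \beta\leadsto EL$; - $v_{\max}\leadsto EL\leadsto\beta$ ( * ); $\ v_{\max}\leadsto EL$; $\ v_{\max}\leadsto\beta$ ( * ); $\ v_{\max}$; - $EL\leadsto\beta$ ( * ); $\ EL$. If $q=\infty$, then the cases $\alpha$, $\alpha\leadsto v_{\max}$ and $v_{\max}$ are excluded, and in every optimal trajectory the positive-velocity phases are followed by a $0$ phase, after the velocity has reached $0$. If $q<\infty$, a final $0$ phase may or may not be present, and if present it cannot follow an $\alpha$ phase or a $v_{\max}$ phase.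
   Context: Let $\alpha,\beta,v_{\max}>0$, $0\le v_0\le v_{\max}$, $d>0$ and $L\ge v_{\max}^2/(2\alpha)$ be constants, and let $q\in(0,\infty]$. Let $T\ge 0$ be a random variable with finite mean having a probability density $f$ that vanishes outside $[0,q)$, is bounded, and is strictly positive, non-increasing and differentiable on $[0,q)$; let $F$ be its cumulative distribution function. Standing assumptions on $d$: if $q\ge v_0/\beta$ then $d\ge v_0^2/(2\beta)$; if $q<v_0/\beta$ then $d\ge q(v_0-q\beta/2)$. Moreover, if $q\le (v_{\max}-v_0)/\alpha$ then $d<q(v_0+q\alpha/2)$, and if $q\ge (v_{\max}-v_0)/\alpha$ then $d<\frac{(v_{\max}-v_0)(v_{\max}+v_0)}{2\alpha}+v_{\max}\bigl(q-\frac{v_{\max}-v_0}{\alpha}\bigr)$ (automatic if $q=\infty$). A function $g:[0,q)\to\mathbb{R}$ is $(\alpha,\beta)$-Lipschitz if $-\beta(t_2-t_1)\le g(t_2)-g(t_1)\le\alpha(t_2-t_1)$ for all $0\le t_1\le t_2<q$. $W$ is the set of $(\alpha,\beta)$-Lipschitz functions $v:[0,q)\to[0,v_{\max}]$ with $v(0)=v_0$ and $\int_0^q v(t)\,dt\le d$. $V\subseteq W$ is the subset of those with $\int_0^q v(t)\,dt=d$. Put $k(x,v)=\frac{1}{2\alpha v_{\max}}(v_{\max}-v)^2+\frac{1}{v_{\max}}(L-x)$, and for $v\in W$ let $S(v)=\int_0^q[t+k(\int_0^t v(s)\,ds,\,v(t))]f(t)\,dt$. An optimal trajectory is a $v^*\in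 V$ minimising $S$ over $W$. For $B\in\mathbb{R}$, the Euler--Lagrange curve with parameter $B$ is $v_{EL}(t)=v_{\max}-\frac{B}{f(t)}-\alpha\frac{F(t)}{f(t)}$, $t\in[0,q)$. It is assumed that for any given $B$ the function $$\dot v_{EL}(t)+\beta=\frac{\dot f(t)\,(B+\alpha F(t))}{f(t)^2}-\alpha+\beta$$ is either positive for all $0\le t<q$, or negative for all $0\le t<q$, or changes sign once from positive to negative in the interval $(0,q)$. Phases: a phase is a maximal time interval on which the trajectory $v^*$ has one of the following types. "$\alpha$": affine with slope $\alpha$. "$\beta$": affine with slope $-\beta$. "$v_{\max}$": constant equal to $v_{\max}$. "$0$": constant equal to $0$. "EL": $v^*$ coincides with an Euler--Lagrange curve. The notation $X\leadsto Y$ means that a phase of type $X$ is immediately followed by a phase of type $Y$. *)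

theory Defs
  imports "HOL-Probability.Probability"
begin

text \<open>
  Trajectories are functions on \<open>[0,q)\<close> with \<open>q \<in> (0,\<infinity>]\<close>; they are represented by functions
  \<open>real \<Rightarrow> real\<close> of which only the values on \<open>horizon q\<close> are ever used.
\<close>

definition horizon :: "ereal \<Rightarrow> real set" where
  "horizon q = {t. 0 \<le> t \<and> ereal t < q}"

definition ab_lipschitz :: "real \<Rightarrow> real \<Rightarrow> ereal \<Rightarrow> (real \<Rightarrow> real) \<Rightarrow> bool" where
  "ab_lipschitz \<alpha> \<beta> q g \<longleftrightarrow>
     (\<forall>t1 \<in> horizon q. \<forall>t2 \<in> horizon q. t1 \<le> t2 \<longrightarrow>
        - \<beta> * (t2 - t1) \<le> g t2 - g t1 \<and> g t2 - g t1 \<le> \<alpha> * (t2 - t1))"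

text \<open>
  The integrability clause matters only for \<open>q = \<infinity>\<close>: a velocity is non-negative, so
  \<open>\<integral> v \<le> d\<close> presupposes that the integral is finite, whereas the Bochner integral of
  a non-integrable function is \<open>0\<close> by convention.
\<close>

definition trajs_W :: "real \<Rightarrow> real \<Rightarrow> real \<Rightarrow> real \<Rightarrow> real \<Rightarrow> ereal \<Rightarrow> (real \<Rightarrow> real) set" where
  "trajs_W \<alpha> \<beta> vmax v0 d q =
     {v. ab_lipschitz \<alpha> \<beta> q v \<and> (\<forall>t \<in> horizon q. 0 \<le> v t \<and> v t \<le> vmax) \<and> v 0 = v0 \<and>
         interval_lebesgue_integrable lborel 0 q v \<and> (LBINT t=0..q. v t) \<le> d}"

definition trajs_V :: "real \<Rightarrow> real \<Rightarrow> real \<Rightarrow> real \<Rightarrow> real \<Rightarrow> ereal \<Rightarrow> (real \<Rightarrow> real) set" where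
  "trajs_V \<alpha> \<beta> vmax v0 d q = {v \<in> trajs_W \<alpha> \<beta> vmax v0 d q. (LBINT t=0..q. v t) = d}"

definition time_to_go :: "real \<Rightarrow> real \<Rightarrow> real \<Rightarrow> real \<Rightarrow> real \<Rightarrow> real" where
  "time_to_go \<alpha> vmax L x v = 1 / (2 * \<alpha> * vmax) * (vmax - v)\<^sup>2 + 1 / vmax * (L - x)"

definition cost_S ::
  "real \<Rightarrow> real \<Rightarrow> real \<Rightarrow> ereal \<Rightarrow> (real \<Rightarrow> real) \<Rightarrow> (real \<Rightarrow> real) \<Rightarrow> real" where
  "cost_S \<alpha> vmax L q f v =
     (LBINT t=0..q. (t + time_to_go \<alpha> vmax L (LBINT s=0..t. v s) (v t)) * f t)"

definition optimal_traj ::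
  "real \<Rightarrow> real \<Rightarrow> real \<Rightarrow> real \<Rightarrow> real \<Rightarrow> real \<Rightarrow> ereal \<Rightarrow> (real \<Rightarrow> real) \<Rightarrow> (real \<Rightarrow> real) \<Rightarrow> bool"
where
  "optimal_traj \<alpha> \<beta> vmax v0 d L q f v \<longleftrightarrow>
     v \<in> trajs_V \<alpha> \<beta> vmax v0 d q \<and>
     (\<forall>w \<in> trajs_W \<alpha> \<beta> vmax v0 d q. cost_S \<alpha> vmax L q f v \<le> cost_S \<alpha> vmax L q f w)"

definition EL_curve ::
  "real \<Rightarrow> real \<Rightarrow> (real \<Rightarrow> real) \<Rightarrow> (real \<Rightarrow> real) \<Rightarrow> real \<Rightarrow> real \<Rightarrow> real" where
  "EL_curve \<alpha> vmax f F B t = vmax - B / f t - \<alpha> * (F t / f t)"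

text \<open>The slope is relative to \<open>[0,q)\<close>, hence a one-sided derivative at \<open>t = 0\<close>.\<close>

definition EL_slope ::
  "real \<Rightarrow> real \<Rightarrow> ereal \<Rightarrow> (real \<Rightarrow> real) \<Rightarrow> (real \<Rightarrow> real) \<Rightarrow> real \<Rightarrow> real \<Rightarrow> real" where
  "EL_slope \<alpha> vmax q f F B t =
     vector_derivative (EL_curve \<alpha> vmax f F B) (at t within horizon q)"

datatype phase_type = Accel | Decel | Cruise | Halt | EL

text \<open>These are the types \<open>\<alpha>\<close>, \<open>\<beta>\<close>, \<open>v\<^sub>m\<^sub>a\<^sub>x\<close>, \<open>0\<close> and Euler--Lagrange.\<close>

fun has_type ::
  "real \<Rightarrow> real \<Rightarrow> real \<Rightarrow> (real \<Rightarrow> real) \<Rightarrow> (real \<Rightarrow> real) \<Rightarrow> (real \<Rightarrow> real) \<Rightarrow> real set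
    \<Rightarrow> phase_type \<Rightarrow> bool" where
  "has_type \<alpha> \<beta> vmax f F v J Accel \<longleftrightarrow> (\<exists>c. \<forall>t \<in> J. v t = c + \<alpha> * t)"
| "has_type \<alpha> \<beta> vmax f F v J Decel \<longleftrightarrow> (\<exists>c. \<forall>t \<in> J. v t = c - \<beta> * t)"
| "has_type \<alpha> \<beta> vmax f F v J Cruise \<longleftrightarrow> (\<forall>t \<in> J. v t = vmax)"
| "has_type \<alpha> \<beta> vmax f F v J Halt \<longleftrightarrow> (\<forall>t \<in> J. v t = 0)"
| "has_type \<alpha> \<beta> vmax f F v J EL \<longleftrightarrow> (\<exists>B. \<forall>t \<in> J. v t = EL_curve \<alpha> vmax f F B t)"

text \<open>
  A phase is a maximal time interval of its type. It must contain two distinct times, since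
  on a single point every trajectory is of type \<open>\<alpha>\<close>, \<open>\<beta>\<close> and Euler--Lagrange.
\<close>

definition is_phase ::
  "real \<Rightarrow> real \<Rightarrow> real \<Rightarrow> ereal \<Rightarrow> (real \<Rightarrow> real) \<Rightarrow> (real \<Rightarrow> real) \<Rightarrow> (real \<Rightarrow> real) \<Rightarrow> real set
    \<Rightarrow> phase_type \<Rightarrow> bool" where
  "is_phase \<alpha> \<beta> vmax q f F v J p \<longleftrightarrow>
     J \<subseteq> horizon q \<and> is_interval J \<and> (\<exists>s \<in> J. \<exists>t \<in> J. s < t) \<and>
     has_type \<alpha> \<beta> vmax f F v J p \<and>
     (\<forall>K. J \<subseteq> K \<and> K \<subseteq> horizon q \<and> is_interval K \<and> has_type \<alpha> \<beta> vmax f F v K p \<longrightarrow> K = J)"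

text \<open>
  The trajectory consists of exactly the phases \<open>ps\<close>, in this order: consecutive phases
  share the switching time \<open>\<tau> i\<close>, and together they cover \<open>[0,q)\<close>.
\<close>

definition phase_sequence ::
  "real \<Rightarrow> real \<Rightarrow> real \<Rightarrow> ereal \<Rightarrow> (real \<Rightarrow> real) \<Rightarrow> (real \<Rightarrow> real) \<Rightarrow> (real \<Rightarrow> real)
    \<Rightarrow> phase_type list \<Rightarrow> bool" where
  "phase_sequence \<alpha> \<beta> vmax q f F v ps \<longleftrightarrow>
     (\<exists>\<tau> :: nat \<Rightarrow> ereal. \<tau> 0 = 0 \<and> \<tau> (length ps) = q \<and>
        (\<forall>i < length ps. \<tau> i < \<tau> (Suc i) \<and>
           is_phase \<alpha> \<beta> vmax q f F v
             {t \<in> horizon q. \<tau> i \<le> ereal t \<and> ereal t \<le> \<tau> (Suc i)} (ps ! i)))"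

text \<open>
  The seventeen possible orders of the phases of positive velocity. The starred ones are those
  that need some Euler--Lagrange curve to fall faster than \<open>\<beta>\<close> while it is positive.
\<close>

definition starred_orders :: "phase_type list set" where
  "starred_orders =
     {[Accel, Decel], [Accel, EL, Decel], [Accel, Cruise, EL, Decel], [Accel, Cruise, Decel],
      [Decel, EL, Decel],
      [Cruise, EL, Decel], [Cruise, Decel],
      [EL, Decel]}"

definition unstarred_orders :: "phase_type list set" where
  "unstarred_orders =
     {[Accel], [Accel, EL], [Accel, Cruise, EL], [Accel, Cruise],
      [Decel], [Decel, EL],
      [Cruise, EL], [Cruise],
      [EL]}"

end

theory Submission
  imports Defs
begin

text \<open>
  Integrating by parts turns the cost into the strictly convex functional
  \<open>\<integral> (vmax - v)\<^sup>2 f - 2 \<alpha> v (1 - F)\<close>, up to constants and a positive factor. Unless \<open>v\<close> is the slowest or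
  the fastest trajectory, separation yields a multiplier \<open>B\<close> for the constraint \<open>\<integral> v = d\<close> such that
  \<open>\<integral> (v - v\<^sub>E\<^sub>L) f (w - v) \<ge> 0\<close> for every Lipschitz competitor \<open>w\<close> whatever its distance.
  Taking for \<open>w\<close> the maximum of \<open>v\<close> with a tent, or the minimum of \<open>v\<close> with a valley, shows that \<open>v\<close> moves as fast as the
  Lipschitz bounds permit towards \<open>v\<^sub>E\<^sub>L\<close> wherever it differs from it. Since \<open>v\<^sub>E\<^sub>L\<close> decreases below \<open>vmax\<close>
  and \<open>v\<^sub>E\<^sub>L(t) + \<beta> t\<close> increases first and decreases afterwards, once \<open>v\<close> has met the curve and left it again it can only brake.
\<close>

section \<open>Euler--Lagrange curves\<close>

text \<open>The contact times of \<open>v\<close> with the curve form merely a closed set. They may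
  accumulate, so there need not be a first interval on which \<open>v\<close> leaves the curve; the
  braking shape is proved from last contacts and then carried over to the infimum of the departure
  times. A multiplier requires competitors of distance both above and below \<open>d\<close>. Only
  the slowest and the fastest trajectory admit no such pair, and their shape is explicit. Tents and
  valleys replace small perturbations because the Lipschitz class is closed under maximum and
  minimum. On the set where such a competitor differs from \<open>v\<close> the integrand has a
  strict sign, so an integral inequality becomes a pointwise one. Finiteness comes from the
  geometry, which always produces one of two fixed words of phase types whose pieces may be empty.
  The possible orders are the subsequences of these words with adjacent repetitions merged. The
  types exclude each other on every nondegenerate interval, so a trajectory has only one sequence of
  phases.\<close>

lemma is_interval_horizon: "is_interval (horizon q)"
  unfolding is_interval_1 horizon_def
  by (auto intro: le_less_trans[of "ereal _" "ereal _" q])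

lemma horizon_Icc_subset:
  assumes "s \<in> horizon q" "t \<in> horizon q"
  shows "{s..t} \<subseteq> horizon q"
  using mem_is_interval_1_I[OF is_interval_horizon assms] by auto

locale el_data =
  fixes \<alpha> \<beta> vmax :: real and q :: ereal and f F :: "real \<Rightarrow> real"
  assumes \<alpha>_pos: "0 < \<alpha>" and \<beta>_pos: "0 < \<beta>" and vmax_pos: "0 < vmax" and q_pos: "0 < q"
    and f_pos: "t \<in> horizon q \<Longrightarrow> 0 < f t"
    and f_antimono: "antimono_on (horizon q) f"
    and f_differentiable: "f differentiable_on horizon q"
    and F_differentiable: "F differentiable_on horizon q"
    and F_strict_mono: "strict_mono_on (horizon q) F"
    and EL_sign: "(\<forall>t \<in> horizon q. 0 < EL_slope \<alpha> vmax q f F B t + \<beta>) \<or>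
                  (\<forall>t \<in> horizon q. EL_slope \<alpha> vmax q f F B t + \<beta> < 0) \<or>
                  (\<exists>t0. 0 < t0 \<and> ereal t0 < q \<and>
                     (\<forall>t \<in> horizon q. t < t0 \<longrightarrow> 0 < EL_slope \<alpha> vmax q f F B t + \<beta>) \<and>
                     (\<forall>t \<in> horizon q. t0 < t \<longrightarrow> EL_slope \<alpha> vmax q f F B t + \<beta> < 0))"
begin

abbreviation H :: "real set" where "H \<equiv> horizon q"
abbreviation E :: "real \<Rightarrow> real \<Rightarrow> real" where "E \<equiv> EL_curve \<alpha> vmax f F"

lemma zero_in_H: "0 \<in> H"
  using q_pos by (simp add: horizon_def flip: zero_ereal_def)

lemma EL_curve_alt: "E B t = vmax - (B + \<alpha> * F t) / f t"
  by (simp add: EL_curve_def add_divide_distrib)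

text \<open>The bound by \<open>vmax\<close> says that the numerator
  \<open>B + \<alpha> * F x\<close> is nonnegative. From there on it grows strictly while the
  denominator \<open>f\<close> does not grow. The bound then persists, so a curve that has come down
  to \<open>vmax\<close> keeps falling.\<close>

lemma EL_curve_decreasing:
  assumes "x \<in> H" "y \<in> H" "x < y" "E B x \<le> vmax"
  shows "E B y < E B x"
proof -
  have fx: "0 < f x" and fy: "0 < f y" and fxy: "f y \<le> f x"
    using f_pos f_antimono assms by (auto simp: monotone_on_def)
  have "0 \<le> B + \<alpha> * F x"
    using assms(4) fx by (simp add: EL_curve_alt zero_le_divide_iff)
  moreover have "\<alpha> * F x < \<alpha> * F y"
    using F_strict_mono assms \<alpha>_pos by (auto simp: monotone_on_def)
  ultimately have "(B + \<alpha> * F x) / f x \<le> (B + \<alpha> * F x) / f y" "(B + \<alpha> * F x) / f y < (B + \<alpha> * F y) / f y"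
    using fx fy fxy by (auto intro!: divide_left_mono divide_strict_right_mono)
  then show ?thesis by (simp add: EL_curve_alt)
qed

lemma EL_curve_differentiable_on: "E B differentiable_on H"
proof -
  have "(\<lambda>t. vmax - (B + \<alpha> * F t) / f t) differentiable_on H"
    unfolding differentiable_on_def
    using f_differentiable F_differentiable f_pos unfolding differentiable_on_def
    by (auto intro!: derivative_intros differentiable_divide simp: less_imp_neq[symmetric])
  then show ?thesis by (simp add: EL_curve_alt[abs_def])
qed

lemma EL_curve_continuous_on: "continuous_on H (E B)"
  using EL_curve_differentiable_on by (rule differentiable_imp_continuous_on)

lemma EL_curve_deriv:
  assumes "t \<in> H"
  shows "(E B has_vector_derivative EL_slope \<alpha> vmax q f F B t) (at t within H)"
  using EL_curve_differentiable_on assms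
  unfolding EL_slope_def differentiable_on_def by (simp add: vector_derivative_works)

lemma EL_curve_mvt:
  assumes "x \<in> H" "y \<in> H" "x < y"
  obtains c where "x < c" "c < y" "c \<in> H"
    "(E B y + \<beta> * y) - (E B x + \<beta> * x) = (EL_slope \<alpha> vmax q f F B c + \<beta>) * (y - x)"
proof -
  have sub: "{x..y} \<subseteq> H" using assms horizon_Icc_subset by blast
  have "((\<lambda>t. E B t + \<beta> * t) has_derivative (\<lambda>h. (EL_slope \<alpha> vmax q f F B t + \<beta>) * h)) (at t within {x..y})"
    if "x \<le> t" "t \<le> y" for t
  proof -
    have "(E B has_vector_derivative EL_slope \<alpha> vmax q f F B t) (at t within {x..y})"
      using has_vector_derivative_within_subset[OF EL_curve_deriv sub] sub that by auto
    then have "((\<lambda>t. E B t + \<beta> * t) has_vector_derivative EL_slope \<alpha> vmax q f F B t + \<beta>) (at t within {x..y})"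
      by (auto intro!: derivative_eq_intros)
    then show ?thesis
      by (simp add: has_vector_derivative_def mult.commute)
  qed
  from mvt_simple[OF assms(3) this] obtain c where "c \<in> {x<..<y}"
    "(E B y + \<beta> * y) - (E B x + \<beta> * x) = (EL_slope \<alpha> vmax q f F B c + \<beta>) * (y - x)"
    by auto
  with sub show thesis by (intro that[of c]) auto
qed

text \<open>By the sign assumption \<open>E B t + \<beta> * t\<close> rises up to a peak and falls
  strictly afterwards, where either half may be missing. A failure to rise between \<open>x\<close>
  and \<open>y\<close> puts the peak before \<open>y\<close>, so only strict descent is left from
  \<open>y\<close> on.\<close>

lemma EL_curve_steep:
  assumes "x \<in> H" "y \<in> H" "x < y" "E B y + \<beta> * y \<le> E B x + \<beta> * x"
    and "w \<in> H" "y \<le> z" "z < w"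
  shows "E B w + \<beta> * w < E B z + \<beta> * z"
proof -
  have "z \<in> H" using horizon_Icc_subset[OF assms(2,5)] assms by auto
  obtain c where c: "x < c" "c < y" "c \<in> H"
    "(E B y + \<beta> * y) - (E B x + \<beta> * x) = (EL_slope \<alpha> vmax q f F B c + \<beta>) * (y - x)"
    using EL_curve_mvt assms by metis
  have nonpos: "EL_slope \<alpha> vmax q f F B c + \<beta> \<le> 0"
    using c assms by (smt (verit) mult_pos_pos)
  obtain e where e: "z < e" "e < w" "e \<in> H"
    "(E B w + \<beta> * w) - (E B z + \<beta> * z) = (EL_slope \<alpha> vmax q f F B e + \<beta>) * (w - z)"
    using EL_curve_mvt \<open>z \<in> H\<close> assms by metis
  have "c < e" using c e assms by simp
  have "EL_slope \<alpha> vmax q f F B e + \<beta> < 0"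
    using EL_sign[of B]
  proof (elim disjE exE conjE)
    \<comment> \<open>The sign exactly at \<open>t0\<close> is not prescribed. A nonpositive value
      at \<open>c\<close> still gives \<open>t0 \<le> c\<close>, and \<open>e\<close> lies strictly
      to the right of \<open>c\<close>.\<close>
    fix t0 assume *: "\<forall>t\<in>H. t < t0 \<longrightarrow> 0 < EL_slope \<alpha> vmax q f F B t + \<beta>"
      "\<forall>t\<in>H. t0 < t \<longrightarrow> EL_slope \<alpha> vmax q f F B t + \<beta> < 0"
    then have "t0 \<le> c" using c(3) nonpos by force
    then show ?thesis using *(2) e(3) \<open>c < e\<close> by auto
  qed (use c e nonpos in force)+
  then have "(EL_slope \<alpha> vmax q f F B e + \<beta>) * (w - z) < 0"
    using assms by (simp add: mult_neg_pos)
  then show ?thesis using e(4) by simp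
qed

text \<open>The condition under which the theorem rules out the starred orders.\<close>

definition EL_never_steep :: bool where
  "EL_never_steep \<longleftrightarrow> (\<forall>B. \<forall>t \<in> H. 0 < E B t \<longrightarrow> - \<beta> \<le> EL_slope \<alpha> vmax q f F B t)"

lemma EL_never_steepD:
  assumes EL_never_steep "x \<in> H" "y \<in> H" "x < y" "\<And>t. x < t \<Longrightarrow> t < y \<Longrightarrow> 0 < E B t"
  shows "E B x + \<beta> * x \<le> E B y + \<beta> * y"
proof -
  obtain c where c: "x < c" "c < y" "c \<in> H"
    "(E B y + \<beta> * y) - (E B x + \<beta> * x) = (EL_slope \<alpha> vmax q f F B c + \<beta>) * (y - x)"
    using EL_curve_mvt assms(2-4) by metis
  then have "0 \<le> EL_slope \<alpha> vmax q f F B c + \<beta>"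
    using assms(1,5) unfolding EL_never_steep_def by force
  then show ?thesis using c assms(4) by (smt (verit) mult_nonneg_nonneg)
qed

lemma ab_lipschitz_continuous_on:
  assumes "ab_lipschitz \<alpha> \<beta> q g"
  shows "continuous_on H g"
proof (rule lipschitz_on_continuous_on)
  show "(\<alpha> + \<beta>)-lipschitz_on H g"
  proof (rule lipschitz_onI)
    have *: "\<bar>g y - g x\<bar> \<le> (\<alpha> + \<beta>) * (y - x)" if "x \<in> H" "y \<in> H" "x \<le> y" for x y
    proof -
      have "0 \<le> \<alpha> * (y - x)" "0 \<le> \<beta> * (y - x)" using \<alpha>_pos \<beta>_pos that by auto
      moreover have "- \<beta> * (y - x) \<le> g y - g x" "g y - g x \<le> \<alpha> * (y - x)"
        using assms that unfolding ab_lipschitz_def by blast+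
      ultimately show ?thesis by (simp add: distrib_right abs_le_iff)
    qed
    show "dist (g x) (g y) \<le> (\<alpha> + \<beta>) * dist x y" if "x \<in> H" "y \<in> H" for x y
      using *[of x y] *[of y x] that by (cases "x \<le> y") (auto simp: dist_real_def abs_minus_commute)
  qed (use \<alpha>_pos \<beta>_pos in auto)
qed

end

locale lipschitz_path = el_data +
  fixes v :: "real \<Rightarrow> real"
  assumes v_lipschitz: "ab_lipschitz \<alpha> \<beta> q v"
    and v_nonneg: "t \<in> horizon q \<Longrightarrow> 0 \<le> v t"
    and v_le: "t \<in> horizon q \<Longrightarrow> v t \<le> vmax"
begin

lemma v_upper: "s \<in> H \<Longrightarrow> t \<in> H \<Longrightarrow> s \<le> t \<Longrightarrow> v t \<le> v s + \<alpha> * (t - s)"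
  using v_lipschitz unfolding ab_lipschitz_def by force

lemma v_lower: "s \<in> H \<Longrightarrow> t \<in> H \<Longrightarrow> s \<le> t \<Longrightarrow> v s - \<beta> * (t - s) \<le> v t"
  using v_lipschitz unfolding ab_lipschitz_def by force

lemma v_continuous_on: "continuous_on H v"
  using v_lipschitz by (rule ab_lipschitz_continuous_on)

end

section \<open>Trajectories against an Euler--Lagrange curve\<close>

lemma continuous_on_eq_Icc_left:
  fixes g h :: "real \<Rightarrow> real"
  assumes "continuous_on {a..b} g" "continuous_on {a..b} h" "a < b"
    and "\<And>x. a < x \<Longrightarrow> x < b \<Longrightarrow> g x = h x"
  shows "x \<in> {a..b} \<Longrightarrow> g x = h x"
proof -
  assume "x \<in> {a..b}"
  have "continuous_on (closure {a<..<b}) (\<lambda>x. g x - h x)"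
    using assms by (auto intro!: continuous_intros simp: closure_greaterThanLessThan)
  moreover have "g x - h x = 0" if "x \<in> {a<..<b}" for x using that assms by auto
  ultimately have "g x - h x = 0"
    using continuous_constant_on_closure[of "{a<..<b}" "\<lambda>x. g x - h x" 0 x] assms(3) \<open>x \<in> {a..b}\<close>
    by (auto simp: closure_greaterThanLessThan)
  then show ?thesis by simp
qed

text \<open>The two rules are the only trace of optimality in the geometric part. A tent leaves the
  point \<open>(s, v s)\<close> with slope \<alpha>, is capped at \<open>vmax\<close> and comes down
  with slope -\<beta> along the line through \<open>(u, y)\<close>; a valley is its mirror image
  with floor 0. Left of \<open>s\<close> the Lipschitz bounds already give the inequality, so the
  curve is compared only to the right of \<open>s\<close>. The point \<open>(u, y)\<close> is free
  and need not lie on the graph of \<open>v\<close>.\<close>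

locale el_path = lipschitz_path +
  fixes B :: real
  assumes tent: "\<lbrakk>s \<in> horizon q; \<And>x. x \<in> horizon q \<Longrightarrow> s < x \<Longrightarrow> v x < y + \<beta> * (u - x) \<Longrightarrow> v x < EL_curve \<alpha> vmax f F B x;
            x \<in> horizon q\<rbrakk>
            \<Longrightarrow> min (v s + \<alpha> * (x - s)) (min vmax (y + \<beta> * (u - x))) \<le> v x"
    and valley: "\<lbrakk>s \<in> horizon q; \<And>x. x \<in> horizon q \<Longrightarrow> s < x \<Longrightarrow> y - \<alpha> * (u - x) < v x \<Longrightarrow> EL_curve \<alpha> vmax f F B x < v x;
            x \<in> horizon q\<rbrakk>
            \<Longrightarrow> v x \<le> max (v s - \<beta> * (x - s)) (max 0 (y - \<alpha> * (u - x)))"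
begin

abbreviation e :: "real \<Rightarrow> real" where "e \<equiv> EL_curve \<alpha> vmax f F B"

definition braking :: "real \<Rightarrow> bool" where
  "braking s \<longleftrightarrow> (\<forall>x \<in> H. s \<le> x \<longrightarrow> v x = max (v s - \<beta> * (x - s)) 0)"

lemma in_H_between: "\<lbrakk>s \<in> H; t \<in> H; s \<le> x; x \<le> t\<rbrakk> \<Longrightarrow> x \<in> H"
  using horizon_Icc_subset[of s q t] by auto

lemma v_continuous_Icc: "\<lbrakk>s \<in> H; t \<in> H\<rbrakk> \<Longrightarrow> continuous_on {s..t} v"
  using v_continuous_on horizon_Icc_subset continuous_on_subset by metis

lemma e_continuous_Icc: "\<lbrakk>s \<in> H; t \<in> H\<rbrakk> \<Longrightarrow> continuous_on {s..t} e"
  using EL_curve_continuous_on horizon_Icc_subset continuous_on_subset by metis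

section \<open>Shape of the trajectory while it stays on one side of the curve\<close>

lemma below_between:
  assumes "s \<in> H" "t \<in> H" "\<And>x. s < x \<Longrightarrow> x < t \<Longrightarrow> v x < e x" "s \<le> x" "x \<le> t"
  shows "v x = min (v s + \<alpha> * (x - s)) (min vmax (v t + \<beta> * (t - x)))"
proof (rule antisym)
  have x: "x \<in> H" using in_H_between assms by blast
  show "v x \<le> min (v s + \<alpha> * (x - s)) (min vmax (v t + \<beta> * (t - x)))"
    using v_upper[of s x] v_lower[of x t] v_le x assms by (simp add: algebra_simps)
  show "min (v s + \<alpha> * (x - s)) (min vmax (v t + \<beta> * (t - x))) \<le> v x"
  \<comment> \<open>The falling side passes through \<open>(t, v t)\<close>. Beyond \<open>t\<close>
    the Lipschitz bound keeps \<open>v\<close> above it, so nothing has to be known about the curve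
    there.\<close>
  proof (rule tent[OF assms(1) _ x])
    fix z assume z: "z \<in> H" "s < z" "v z < v t + \<beta> * (t - z)"
    have "z < t"
    proof (rule ccontr)
      assume "\<not> z < t"
      then show False using v_lower[of t z] z assms by (simp add: algebra_simps)
    qed
    then show "v z < e z" using assms(3) z by blast
  qed
qed

lemma below_forever:
  assumes "s \<in> H" "\<And>x. x \<in> H \<Longrightarrow> s < x \<Longrightarrow> v x < e x" "x \<in> H" "s \<le> x"
  shows "v x = min (v s + \<alpha> * (x - s)) vmax"
  \<comment> \<open>With the falling side through \<open>(x, vmax)\<close>, the tent takes exactly
    the claimed value at \<open>x\<close>.\<close>
  using tent[OF assms(1) _ assms(3), of vmax x] assms v_upper[of s x] v_le[of x]
  by (intro antisym) auto

lemma above_between: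
  assumes "s \<in> H" "t \<in> H" "\<And>x. s < x \<Longrightarrow> x < t \<Longrightarrow> e x < v x" "s \<le> x" "x \<le> t"
  shows "v x = max (v s - \<beta> * (x - s)) (max 0 (v t - \<alpha> * (t - x)))"
proof (rule antisym)
  have x: "x \<in> H" using in_H_between assms by blast
  show "max (v s - \<beta> * (x - s)) (max 0 (v t - \<alpha> * (t - x))) \<le> v x"
    using v_lower[of s x] v_upper[of x t] v_nonneg x assms by (simp add: algebra_simps)
  show "v x \<le> max (v s - \<beta> * (x - s)) (max 0 (v t - \<alpha> * (t - x)))"
  proof (rule valley[OF assms(1) _ x])
    fix z assume z: "z \<in> H" "s < z" "v t - \<alpha> * (t - z) < v z"
    have "z < t"
    proof (rule ccontr)
      assume "\<not> z < t"
      then show False using v_upper[of t z] z assms by (simp add: algebra_simps)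
    qed
    then show "e z < v z" using assms(3) z by blast
  qed
qed

lemma above_forever:
  assumes "s \<in> H" "\<And>x. x \<in> H \<Longrightarrow> s < x \<Longrightarrow> e x < v x"
  shows "braking s"
  unfolding braking_def
proof (intro ballI impI)
  fix x assume "x \<in> H" "s \<le> x"
  \<comment> \<open>Mirror choice: the rising side of the valley passes through
    \<open>(x, 0)\<close>.\<close>
  then show "v x = max (v s - \<beta> * (x - s)) 0"
    using valley[OF assms(1) _ \<open>x \<in> H\<close>, of 0 x] assms v_lower[of s x] v_nonneg[of x]
    by (intro antisym) auto
qed

text \<open>The rising arm of the valley ends at the height \<open>v t = e t\<close>. The curve
  decreases, so this height lies below \<open>e z\<close> and hence below \<open>v z\<close>, and so
  does the floor 0. Only the braking arm can carry \<open>v\<close>.\<close>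

lemma above_between_decel:
  assumes "s \<in> H" "t \<in> H" "s < t" "v t = e t" "\<And>x. s < x \<Longrightarrow> x < t \<Longrightarrow> e x < v x" "s \<le> x" "x \<le> t"
  shows "v x = v s - \<beta> * (x - s)"
proof -
  have "v z = v s - \<beta> * (z - s)" if z: "s < z" "z < t" for z
  proof -
    have zH: "z \<in> H" using in_H_between[OF assms(1,2), of z] z by simp
    have "e z < v z" using assms(5) z by blast
    moreover have "e t < e z"
      using EL_curve_decreasing[of z t B] zH assms(2) z v_le[OF zH] \<open>e z < v z\<close> by linarith
    moreover have "0 \<le> v t" "0 \<le> \<alpha> * (t - z)" using v_nonneg[OF assms(2)] z \<alpha>_pos by auto
    ultimately show ?thesis
      using above_between[OF assms(1,2,5), of z] assms(4) z by simp
  qed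
  then show ?thesis
    using assms(3,6,7) v_continuous_Icc[OF assms(1,2)]
    by (intro continuous_on_eq_Icc_left[of s t v "\<lambda>z. v s - \<beta> * (z - s)" x]) (auto intro!: continuous_intros)
qed

section \<open>Contact times and what follows them\<close>

lemma contact_left:
  assumes "r \<in> H" "t \<in> H" "r \<le> t" "v r = e r" "v t \<noteq> e t"
  obtains a where "r \<le> a" "a < t" "v a = e a" "\<And>x. a < x \<Longrightarrow> x \<le> t \<Longrightarrow> v x \<noteq> e x"
proof -
  let ?Z = "{x \<in> {r..t}. v x - e x = 0}"
  have "closed ?Z"
    using v_continuous_Icc e_continuous_Icc assms
    by (intro continuous_closed_preimage_constant continuous_intros) auto
  then have "compact ({r..t} \<inter> ?Z)" by (intro compact_Int_closed) auto
  moreover have "{r..t} \<inter> ?Z = ?Z" by auto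
  ultimately have "compact ?Z" by simp
  moreover have "r \<in> ?Z" using assms by auto
  ultimately obtain a where a: "a \<in> ?Z" "\<And>x. x \<in> ?Z \<Longrightarrow> x \<le> a"
    using compact_attains_sup[of ?Z] by blast
  show thesis
  proof
    show "r \<le> a" "v a = e a" using a by auto
    show "a < t" using a assms by (metis (mono_tags, lifting) atLeastAtMost_iff eq_iff_diff_eq_0 mem_Collect_eq order_le_less)
    show "v x \<noteq> e x" if "a < x" "x \<le> t" for x
    proof
      assume "v x = e x"
      then have "x \<in> ?Z" using that \<open>r \<le> a\<close> by auto
      then show False using a(2) that by force
    qed
  qed
qed

lemma contact_right:
  assumes "t \<in> H" "r \<in> H" "t \<le> r" "v r = e r" "v t \<noteq> e t"
  obtains b where "b \<le> r" "t < b" "v b = e b" "\<And>x. t \<le> x \<Longrightarrow> x < b \<Longrightarrow> v x \<noteq> e x"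
proof -
  let ?Z = "{x \<in> {t..r}. v x - e x = 0}"
  have "closed ?Z"
    using v_continuous_Icc e_continuous_Icc assms
    by (intro continuous_closed_preimage_constant continuous_intros) auto
  then have "compact ({t..r} \<inter> ?Z)" by (intro compact_Int_closed) auto
  moreover have "{t..r} \<inter> ?Z = ?Z" by auto
  ultimately have "compact ?Z" by simp
  moreover have "r \<in> ?Z" using assms by auto
  ultimately obtain b where b: "b \<in> ?Z" "\<And>x. x \<in> ?Z \<Longrightarrow> b \<le> x"
    using compact_attains_inf[of ?Z] by blast
  show thesis
  proof
    show "b \<le> r" "v b = e b" using b by auto
    show "t < b" using b assms by (metis (mono_tags, lifting) atLeastAtMost_iff eq_iff_diff_eq_0 mem_Collect_eq order_le_less)
    show "v x \<noteq> e x" if "t \<le> x" "x < b" for x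
    proof
      assume "v x = e x"
      then have "x \<in> ?Z" using that \<open>b \<le> r\<close> by auto
      then show False using b(2) that by force
    qed
  qed
qed

lemma sign_constant:
  assumes "s \<in> H" "t \<in> H" "s \<le> t" "\<And>x. s \<le> x \<Longrightarrow> x \<le> t \<Longrightarrow> v x \<noteq> e x"
  shows "v s < e s \<longleftrightarrow> v t < e t"
proof -
  have cont: "continuous_on {s..t} (\<lambda>x. v x - e x)" 
    using v_continuous_Icc e_continuous_Icc assms by (intro continuous_intros) auto
  show ?thesis
    using IVT'[of "\<lambda>x. v x - e x" s 0 t, OF _ _ assms(3) cont]
      IVT2'[of "\<lambda>x. v x - e x" t 0 s, OF _ _ assms(3) cont] assms
    by (smt (verit, best))
qed

text \<open>Once \<open>v\<close> touches the Euler--Lagrange curve from below while braking, the curve has become steeper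
  than \<open>-\<beta>\<close> for good, so \<open>v\<close> stays above it.\<close>

lemma braking_from_below:
  assumes "s \<in> H" "b \<in> H" "s < b" "v b = e b"
    and dec: "\<And>x. s \<le> x \<Longrightarrow> x \<le> b \<Longrightarrow> v x = v b + \<beta> * (b - x)"
    and below: "\<And>x. s < x \<Longrightarrow> x < b \<Longrightarrow> v x < e x"
  shows "braking s \<and> \<not> EL_never_steep"
proof -
  define m where "m = (s + b) / 2"
  have "s < m" "m < b" using \<open>s < b\<close> by (simp_all add: m_def)
  then have m: "s < m" "m < b" "m \<in> H"
    using in_H_between[OF assms(1,2), of m] by simp_all
  \<comment> \<open>While \<open>v\<close> brakes, \<open>v x + \<beta> * x\<close> is constant. The
    curve lies above \<open>v\<close> at \<open>m\<close> and meets it at \<open>b\<close>, so the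
    same sum for the curve has dropped; this starts \<open>EL_curve_steep\<close>.\<close>
  have phi: "e b + \<beta> * b < e m + \<beta> * m"
    using dec[of m] below[of m] m assms(1-4) by (simp add: algebra_simps)
  have "e x < v x" if "x \<in> H" "b < x" for x
    using EL_curve_steep[of m b B x b] m assms(1-4) phi that v_lower[of b x] by (simp add: algebra_simps)
  then have "braking b" by (intro above_forever assms(1-4)) auto
  have "v x = max (v s - \<beta> * (x - s)) 0" if "x \<in> H" "s \<le> x" for x
  proof (cases "x \<le> b")
    case True
    then show ?thesis using dec[of x] dec[of s] that assms(1-4) v_nonneg[of x] by (simp add: algebra_simps)
  next
    case False
    then have "v x = max (v b - \<beta> * (x - b)) 0" using \<open>braking b\<close> that by (auto simp: braking_def)
    then show ?thesis using dec[of s] assms(1-4) by (simp add: algebra_simps)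
  qed
  then have "braking s" by (simp add: braking_def)
  moreover have "\<not> EL_never_steep"
  proof
    assume EL_never_steep
    then have "e m + \<beta> * m \<le> e b + \<beta> * b"
    proof (rule EL_never_steepD)
      fix t assume t: "m < t" "t < b"
      then have "t \<in> H" using in_H_between[of m b t] m assms(1-4) by auto
      then show "0 < e t" using below[of t] m t v_nonneg[of t] by auto
    qed (use m assms(1-4) in auto)
    then show False using phi by simp
  qed
  ultimately show ?thesis ..
qed

text \<open>Suppose \<open>v\<close> came back to the curve at \<open>b\<close>. It would brake on
  all of \<open>{a..b}\<close>, so \<open>e x + \<beta> * x\<close> would agree at \<open>a\<close>
  and \<open>b\<close> but be smaller at \<open>t\<close> in between, whereas it can only fall after
  its first drop. So \<open>v\<close> stays above and brakes for good. This forces a drop of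
  \<open>e x + \<beta> * x\<close> right after \<open>a\<close>, which \<open>EL_never_steep\<close>
  forbids unless \<open>v a = 0\<close>.\<close>

lemma braking_after_contact_above:
  assumes "a \<in> H" "t \<in> H" "a < t" "v a = e a" "\<And>x. a < x \<Longrightarrow> x \<le> t \<Longrightarrow> e x < v x"
  shows "braking a \<and> (EL_never_steep \<longrightarrow> v a = 0)"
proof -
  have forever: "e x < v x" if x: "x \<in> H" "a < x" for x
  proof (rule ccontr)
    assume "\<not> e x < v x"
    then have "t < x" using assms(5)[of x] x by force
    have ev: "\<exists>b \<in> H. t < b \<and> v b = e b \<and> (\<forall>x. t \<le> x \<longrightarrow> x < b \<longrightarrow> e x < v x)"
    proof -
      have ex: "\<exists>r. t \<le> r \<and> r \<le> x \<and> v r - e r = 0"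
        using \<open>\<not> e x < v x\<close> assms(5)[of t] assms(2,3) \<open>t < x\<close> x v_continuous_Icc[of t x] e_continuous_Icc[of t x]
        by (intro IVT2') (auto intro!: continuous_intros)
      have ne: "v t \<noteq> e t" using assms(5)[of t] \<open>a < t\<close> by simp
      from ex obtain r where r: "t \<le> r" "r \<le> x" "v r = e r" by auto
      then have "r \<in> H" using in_H_between[of t x r] assms x by auto
      obtain b where b: "b \<le> r" "t < b" "v b = e b" "\<And>z. t \<le> z \<Longrightarrow> z < b \<Longrightarrow> v z \<noteq> e z"
        using contact_right[OF assms(2) \<open>r \<in> H\<close> r(1,3) ne] by metis
      have bH: "b \<in> H" using in_H_between[of t r b] b assms \<open>r \<in> H\<close> by auto
      moreover have "e z < v z" if z: "t \<le> z" "z < b" for z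
      proof -
        have "z \<in> H" using in_H_between[of t b z] z assms bH by auto
        then have "\<not> v z < e z"
          using sign_constant[of t z] b(4) z assms by force
        then show ?thesis using b(4)[of z] z by force
      qed
      ultimately show ?thesis using b by blast
    qed
    then obtain b where b: "b \<in> H" "t < b" "v b = e b" "\<And>x. t \<le> x \<Longrightarrow> x < b \<Longrightarrow> e x < v x" by blast
    have *: "e z < v z" if "a < z" "z < b" for z
      using b assms that by (cases "z \<le> t") auto
    have dec: "v z = v a - \<beta> * (z - a)" if "a \<le> z" "z \<le> b" for z
      using above_between_decel[of a b z] that assms b * by auto
    have "e t + \<beta> * t < e a + \<beta> * a"
      using dec[of t] b(2) assms(3,4) *[OF assms(3) b(2)] by (simp add: algebra_simps)
    then have "e b + \<beta> * b < e t + \<beta> * t"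
      using EL_curve_steep[of a t B b t] assms b by simp
    moreover have "e b + \<beta> * b = e a + \<beta> * a"
      using dec[of b] b assms by (simp add: algebra_simps)
    ultimately show False using \<open>e t + \<beta> * t < e a + \<beta> * a\<close> by simp
  qed
  have "braking a" by (rule above_forever[OF assms(1) forever])
  moreover have "v a = 0" if EL_never_steep
  proof (rule ccontr)
    assume "v a \<noteq> 0"
    then have "0 < e a" using v_nonneg[of a] assms by force
    have "continuous_on {a..t} e" using e_continuous_Icc assms by auto
    then have "(e \<longlongrightarrow> e a) (at a within {a..t})"
      using assms by (auto simp: continuous_on_def)
    then have "\<forall>\<^sub>F x in at a within {a..t}. 0 < e x"
      using \<open>0 < e a\<close> by (rule order_tendstoD)
    then obtain \<delta> where \<delta>: "\<delta> > 0" "\<And>x. x \<in> {a..t} \<Longrightarrow> x \<noteq> a \<Longrightarrow> dist x a < \<delta> \<Longrightarrow> 0 < e x"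
      by (auto simp: eventually_at)
    \<comment> \<open>A time after \<open>a\<close> at which the inequality with the curve is known,
      before which the curve stays positive (\<open>\<delta> / 2\<close>), and until which braking
      has not been cut off at velocity 0 (\<open>v a / \<beta>\<close>).\<close>
    define x where "x = min t (a + min (\<delta> / 2) (v a / \<beta>))"
    have x: "a < x" "x \<le> t" "x < a + \<delta>" "x \<le> a + v a / \<beta>"
      using assms \<delta>(1) \<open>0 < e a\<close> \<beta>_pos by (auto simp: x_def)
    have xH: "x \<in> H" using in_H_between[of a t x] x assms by auto
    have "v x = v a - \<beta> * (x - a)"
      using \<open>braking a\<close> xH x \<beta>_pos unfolding braking_def by (force simp: field_simps)
    then have "e x + \<beta> * x < e a + \<beta> * a"
      using assms(5)[of x] x assms(4) by (simp add: algebra_simps)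
    moreover have "e a + \<beta> * a \<le> e x + \<beta> * x"
      using \<open>EL_never_steep\<close>
    proof (rule EL_never_steepD)
      show "0 < e z" if "a < z" "z < x" for z
        using \<delta>(2)[of z] that x by (auto simp: dist_real_def)
    qed (use assms xH x in auto)
    ultimately show False by simp
  qed
  ultimately show ?thesis by blast
qed

text \<open>The curve decreases after the contact. If \<open>v\<close> stayed below forever it would
  speed up or cruise, contradicting that it lies under a falling curve. Hence it meets the curve
  again at some \<open>b\<close>, and in between it can only brake towards \<open>b\<close>, which
  is the situation of \<open>braking_from_below\<close>.\<close>

lemma braking_after_contact_below:
  assumes "a \<in> H" "t \<in> H" "a < t" "v a = e a" "\<And>x. a < x \<Longrightarrow> x \<le> t \<Longrightarrow> v x < e x"
  shows "braking a \<and> \<not> EL_never_steep"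
proof -
  have e_dec: "e x < e a" if "x \<in> H" "a < x" for x
    using EL_curve_decreasing[of a x B] assms that v_le[OF assms(1)] by simp
  have "\<exists>x \<in> H. a < x \<and> \<not> v x < e x"
  proof (rule ccontr)
    assume "\<not> ?thesis"
    then have "v t = min (v a + \<alpha> * (t - a)) vmax"
      using below_forever[of a t] assms by auto
    moreover have "0 \<le> \<alpha> * (t - a)" using \<alpha>_pos assms by simp
    ultimately have "v a \<le> v t" using v_le[of a] assms by auto
    then show False using e_dec[of t] assms(4) assms(5)[of t] assms(2,3) by auto
  qed
  then obtain x where x: "x \<in> H" "a < x" "\<not> v x < e x" by blast
  then have "t < x" using assms(5)[of x] by force
  have ex: "\<exists>r. t \<le> r \<and> r \<le> x \<and> v r - e r = 0"
    using x assms(5)[of t] assms(2,3) \<open>t < x\<close> v_continuous_Icc[of t x] e_continuous_Icc[of t x]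
    by (intro IVT') (auto intro!: continuous_intros)
  have ne: "v t \<noteq> e t" using assms(5)[of t] \<open>a < t\<close> by simp
  from ex obtain r where r: "t \<le> r" "r \<le> x" "v r = e r" by auto
  then have "r \<in> H" using in_H_between[of t x r] assms x by auto
  obtain b where b: "b \<le> r" "t < b" "v b = e b" "\<And>z. t \<le> z \<Longrightarrow> z < b \<Longrightarrow> v z \<noteq> e z"
    using contact_right[OF assms(2) \<open>r \<in> H\<close> r(1,3) ne] by metis
  have bH: "b \<in> H" using in_H_between[of t r b] b assms \<open>r \<in> H\<close> by auto
  have below: "v z < e z" if z: "a < z" "z < b" for z
  proof (cases "z \<le> t")
    case False
    then have "z \<in> H" using in_H_between[of t b z] z assms bH by auto
    then show ?thesis
      using sign_constant[of t z] b(4) z assms False by force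
  qed (use assms z in auto)
  have "v z = v b + \<beta> * (b - z)" if z: "a < z" "z < b" for z
  proof -
    have zH: "z \<in> H" using in_H_between[of a b z] z assms bH by auto
    \<comment> \<open>These exclude the accelerating arm and the cap \<open>vmax\<close> from the
      minimum given by \<open>below_between\<close>.\<close>
    have "v z < v a" "v z < vmax" "0 \<le> \<alpha> * (z - a)"
      using e_dec[OF zH] below[OF z] assms v_le[of a] z \<alpha>_pos by auto
    then show ?thesis
      using below_between[of a b z] below assms bH z by auto
  qed
  then have "v z = v b + \<beta> * (b - z)" if "a \<le> z" "z \<le> b" for z
    using that assms(3) b(2) v_continuous_Icc[OF assms(1) bH]
    by (intro continuous_on_eq_Icc_left[of a b v "\<lambda>z. v b + \<beta> * (b - z)" z]) (auto intro!: continuous_intros)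
  then show ?thesis
    using braking_from_below[of a b] assms b bH below by auto
qed

lemma braking_after_contact:
  assumes "a \<in> H" "t \<in> H" "a < t" "v a = e a" "\<And>x. a < x \<Longrightarrow> x \<le> t \<Longrightarrow> v x \<noteq> e x"
  shows "braking a \<and> (EL_never_steep \<longrightarrow> v a = 0)"
proof -
  have same: "v x < e x \<longleftrightarrow> v t < e t" if "a < x" "x \<le> t" for x
    using sign_constant[of x t] in_H_between[of a t x] that assms by auto
  show ?thesis
  proof (cases "v t < e t")
    case True
    then show ?thesis using braking_after_contact_below[OF assms(1-4)] same by blast
  next
    case False
    have "e x < v x" if "a < x" "x \<le> t" for x
      using same[OF that] False assms(5)[OF that] by auto
    then show ?thesis using braking_after_contact_above[OF assms(1-4)] by blast
  qed
qed

text \<open>Handles contacts that accumulate at \<open>c\<close> from the right: braking is then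
  known only at times arbitrarily close to \<open>c\<close>.\<close>

lemma braking_limit:
  assumes "c \<in> H" "\<And>\<epsilon>. 0 < \<epsilon> \<Longrightarrow> \<exists>a \<in> H. c \<le> a \<and> a < c + \<epsilon> \<and> braking a"
  shows "braking c"
  unfolding braking_def
proof (intro ballI impI)
  fix x assume x: "x \<in> H" "c \<le> x"
  show "v x = max (v c - \<beta> * (x - c)) 0"
  proof (cases "c = x")
    case True
    then show ?thesis using v_nonneg x by simp
  next
    case False
    have "v x \<le> max (v c - \<beta> * (x - c)) 0"
    proof (rule field_le_epsilon)
      fix \<epsilon> :: real assume "0 < \<epsilon>"
      \<comment> \<open>Starting to brake at \<open>a\<close> instead of \<open>c\<close> can add at
        most \<open>\<alpha> * (a - c)\<close> to the initial velocity and
        \<open>\<beta> * (a - c)\<close> through the delay.\<close>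
      define \<delta> where "\<delta> = min (x - c) (\<epsilon> / (\<alpha> + \<beta>))"
      have "0 < \<delta>" using \<open>0 < \<epsilon>\<close> \<alpha>_pos \<beta>_pos x False by (auto simp: \<delta>_def)
      then obtain a where a: "a \<in> H" "c \<le> a" "a < c + \<delta>" "braking a" using assms(2) by blast
      have "a \<le> x" "a - c \<le> \<epsilon> / (\<alpha> + \<beta>)" using a by (auto simp: \<delta>_def)
      then have "v x = max (v a - \<beta> * (x - a)) 0" using \<open>braking a\<close> x(1) unfolding braking_def by blast
      moreover have "v a \<le> v c + \<alpha> * (a - c)" using v_upper assms a by auto
      moreover have "(\<alpha> + \<beta>) * (a - c) \<le> \<epsilon>" 
        using \<open>a - c \<le> \<epsilon> / (\<alpha> + \<beta>)\<close> \<alpha>_pos \<beta>_pos by (simp add: field_simps)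
      ultimately show "v x \<le> max (v c - \<beta> * (x - c)) 0 + \<epsilon>"
        using \<open>0 < \<epsilon>\<close> by (simp add: algebra_simps max_def split: if_splits)
    qed
    then show ?thesis using v_lower[of c x] v_nonneg[of x] assms x by auto
  qed
qed

text \<open>Here \<open>c\<close> is the infimum of the times at which \<open>v\<close> is off the
  curve. Each such time close to \<open>c\<close> is preceded by a last contact, itself at or after
  \<open>c\<close>, from which \<open>v\<close> brakes; these contacts approach \<open>c\<close>. If
  the curves are never steep, the velocity vanishes at them and therefore at
  \<open>c\<close>.\<close>

lemma contact_structure:
  assumes "r \<in> H" "v r = e r"
  obtains (EL) "\<And>x. x \<in> H \<Longrightarrow> r \<le> x \<Longrightarrow> v x = e x"
  | (braking) c where "c \<in> H" "r \<le> c" "\<And>x. r \<le> x \<Longrightarrow> x \<le> c \<Longrightarrow> v x = e x"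
      "braking c" "EL_never_steep \<Longrightarrow> v c = 0"
proof (cases "\<forall>x \<in> H. r \<le> x \<longrightarrow> v x = e x")
  case True
  then show thesis using EL by blast
next
  case False
  define U where "U = {x \<in> H. r \<le> x \<and> v x \<noteq> e x}"
  have "U \<noteq> {}" using False by (auto simp: U_def)
  have bdd: "bdd_below U" by (auto simp: U_def bdd_below_def)
  define c where "c = Inf U"
  have "r \<le> c" unfolding c_def using \<open>U \<noteq> {}\<close> by (intro cInf_greatest) (auto simp: U_def)
  have c_le: "c \<le> x" if "x \<in> U" for x unfolding c_def using that bdd by (rule cInf_lower)
  have cH: "c \<in> H" using \<open>U \<noteq> {}\<close> c_le in_H_between[of r _ c] \<open>r \<le> c\<close> assms by (auto simp: U_def)
  have eq: "v x = e x" if "r \<le> x" "x < c" for x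
    using c_le[of x] in_H_between[of r c x] that assms cH by (force simp: U_def)
  have eqc: "v x = e x" if "r \<le> x" "x \<le> c" for x
  proof (cases "r = c")
    case False
    then show ?thesis
      using continuous_on_eq_Icc_left[of r c v e x] v_continuous_Icc e_continuous_Icc eq that assms cH by auto
  qed (use that assms in auto)
  have near: "\<exists>a \<in> H. c \<le> a \<and> a < c + \<epsilon> \<and> braking a \<and> (EL_never_steep \<longrightarrow> v a = 0)" if "0 < \<epsilon>" for \<epsilon>
  proof -
    obtain t where t: "t \<in> U" "t < c + \<epsilon>"
      using cInf_lessD[OF \<open>U \<noteq> {}\<close>, of "c + \<epsilon>"] \<open>0 < \<epsilon>\<close> unfolding c_def by auto
    then have tH: "t \<in> H" by (simp add: U_def)
    obtain a where a: "r \<le> a" "a < t" "v a = e a" "\<And>x. a < x \<Longrightarrow> x \<le> t \<Longrightarrow> v x \<noteq> e x"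
      using contact_left[of r t] t assms by (auto simp: U_def)
    have aH: "a \<in> H" using in_H_between[of r t a] a assms tH by auto
    have "c \<le> a"
    proof (rule ccontr)
      assume "\<not> c \<le> a"
      \<comment> \<open>This midpoint lies after the last contact \<open>a\<close> before
        \<open>t\<close>, yet before \<open>c\<close>, where \<open>v\<close> follows the
        curve.\<close>
      then have "v ((a + min c t) / 2) \<noteq> e ((a + min c t) / 2)" using a by auto
      moreover have "v ((a + min c t) / 2) = e ((a + min c t) / 2)" 
        using a \<open>\<not> c \<le> a\<close> by (intro eq) (auto simp: min_def split: if_splits)
      ultimately show False by simp
    qed
    then show ?thesis
      using braking_after_contact[OF aH tH a(2,3,4)] aH t a by force
  qed
  have bc: "braking c" using braking_limit[OF cH] near by blast
  have vc: "v c = 0" if ns: EL_never_steep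
  proof (rule antisym)
    show "v c \<le> 0"
    proof (rule field_le_epsilon)
      fix \<epsilon> :: real assume "0 < \<epsilon>"
      then have "0 < \<epsilon> / \<beta>" using \<beta>_pos by simp
      from near[OF this] ns obtain a where a: "a \<in> H" "c \<le> a" "a < c + \<epsilon> / \<beta>" "v a = 0" by blast
      then have "\<beta> * (a - c) \<le> \<epsilon>" using \<beta>_pos by (simp add: field_simps)
      then show "v c \<le> 0 + \<epsilon>" using v_lower[of c a] a cH by simp
    qed
  qed (use cH v_nonneg in auto)
  from eqc bc vc show thesis by (rule braking[OF cH \<open>r \<le> c\<close>])
qed

section \<open>Behaviour before the first contact\<close>

lemma start_below:
  assumes "v 0 < e 0"
  obtains (forever) "\<And>x. x \<in> H \<Longrightarrow> v x = min (v 0 + \<alpha> * x) vmax"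
  | (contact) s where "s \<in> H" "\<And>x. 0 \<le> x \<Longrightarrow> x \<le> s \<Longrightarrow> v x = min (v 0 + \<alpha> * x) vmax" "v s = e s"
  | (braking) s where "s \<in> H" "\<And>x. 0 \<le> x \<Longrightarrow> x \<le> s \<Longrightarrow> v x = min (v 0 + \<alpha> * x) vmax"
      "braking s" "\<not> EL_never_steep"
proof (cases "\<forall>x \<in> H. v x \<noteq> e x")
  case True
  have "v x < e x" if "x \<in> H" for x
    using sign_constant[of 0 x] True that assms zero_in_H in_H_between[of 0 x] by (auto simp: horizon_def)
  then have "v x = min (v 0 + \<alpha> * x) vmax" if "x \<in> H" for x
    using below_forever[of 0 x] zero_in_H that by (auto simp: horizon_def)
  then show thesis by (rule forever)
next
  case False
  then obtain r where r: "r \<in> H" "v r = e r" by auto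
  have ne: "v 0 \<noteq> e 0" using assms by simp
  have r0: "0 \<le> r" using r by (auto simp: horizon_def)
  obtain b where b: "b \<le> r" "0 < b" "v b = e b" "\<And>x. 0 \<le> x \<Longrightarrow> x < b \<Longrightarrow> v x \<noteq> e x"
    using contact_right[OF zero_in_H r(1) r0 r(2) ne] by metis
  have bH: "b \<in> H" using in_H_between[of 0 r b] b r zero_in_H by auto
  have below: "v x < e x" if "0 \<le> x" "x < b" for x
    using sign_constant[of 0 x] b(4) in_H_between[of 0 b x] that assms bH zero_in_H by force
  have shape: "v x = min (v 0 + \<alpha> * x) (min vmax (v b + \<beta> * (b - x)))" if "0 \<le> x" "x \<le> b" for x
    using below_between[of 0 b x] below that bH zero_in_H by auto
  \<comment> \<open>Height of the braking line into the first contact \<open>b\<close> over the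
    accelerate-and-cruise path. It is nonincreasing, so its zero \<open>s\<close> splits
    \<open>{0..b}\<close> into a part where \<open>v\<close> follows that path and a part where it
    brakes into \<open>b\<close>.\<close>
  define D where "D = (\<lambda>x. v b + \<beta> * (b - x) - min (v 0 + \<alpha> * x) vmax)"
  have mono: "D y \<le> D x" if "x \<le> y" for x y
  proof -
    have "\<alpha> * x \<le> \<alpha> * y" "\<beta> * x \<le> \<beta> * y" using that \<alpha>_pos \<beta>_pos by auto
    then show ?thesis by (auto simp: D_def algebra_simps min_def)
  qed
  have "\<exists>s. 0 \<le> s \<and> s \<le> b \<and> (\<forall>x. 0 \<le> x \<longrightarrow> x \<le> s \<longrightarrow> s = 0 \<or> 0 \<le> D x) \<and> (\<forall>x. s \<le> x \<longrightarrow> x \<le> b \<longrightarrow> D x \<le> 0)"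
  proof (cases "0 \<le> D 0")
    case True
    have "D b \<le> 0" using shape[of b] b by (auto simp: D_def min_def split: if_splits)
    moreover have "continuous_on {0..b} D" unfolding D_def by (intro continuous_intros)
    ultimately obtain s where s: "0 \<le> s" "s \<le> b" "D s = 0"
      using True b IVT2'[of D b 0 0] by auto
    then show ?thesis using mono by metis
  next
    case False
    then show ?thesis using mono b by (intro exI[of _ 0]) force
  qed
  then obtain s where s: "0 \<le> s" "s \<le> b" "\<And>x. 0 \<le> x \<Longrightarrow> x \<le> s \<Longrightarrow> s = 0 \<or> 0 \<le> D x"
    "\<And>x. s \<le> x \<Longrightarrow> x \<le> b \<Longrightarrow> D x \<le> 0" by blast
  have sH: "s \<in> H" using in_H_between[of 0 b s] s bH zero_in_H by auto
  have ac: "v x = min (v 0 + \<alpha> * x) vmax" if "0 \<le> x" "x \<le> s" for x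
  proof (cases "s = 0")
    case True
    then show ?thesis using that v_le[of 0] zero_in_H by auto
  next
    case False
    then show ?thesis using shape[of x] s(2) s(3)[OF that] that unfolding D_def by linarith
  qed
  show thesis
  proof (cases "s = b")
    case True
    with b(3) have "v s = e s" by simp
    with ac show thesis by (rule contact[OF sH])
  next
    case False
    have dec: "v x = v b + \<beta> * (b - x)" if "s \<le> x" "x \<le> b" for x
      using shape[of x] s(4)[of x] that s(1) by (auto simp: D_def min_def split: if_splits)
    have "s < b" using False s(2) by simp
    have "v x < e x" if "s < x" "x < b" for x using below[of x] s(1) that by simp
    \<comment> \<open>Here the braking line takes over before \<open>b\<close>, so \<open>v\<close>
      reaches the curve from below while braking.\<close>
    with dec have "braking s \<and> \<not> EL_never_steep"
      by (rule braking_from_below[OF sH bH \<open>s < b\<close> b(3)])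
    then have "braking s" "\<not> EL_never_steep" by blast+
    with ac show thesis by (rule braking[OF sH])
  qed
qed

lemma start_above:
  assumes "e 0 < v 0"
  obtains (braking) "braking 0"
  | (contact) b where "b \<in> H" "\<And>x. 0 \<le> x \<Longrightarrow> x \<le> b \<Longrightarrow> v x = v 0 - \<beta> * x" "v b = e b"
proof (cases "\<forall>x \<in> H. v x \<noteq> e x")
  case True
  have "\<not> v x < e x" if "x \<in> H" for x
    using sign_constant[of 0 x] True that assms zero_in_H in_H_between[of 0 x] by (auto simp: horizon_def)
  then have "e x < v x" if "x \<in> H" for x using True that by force
  then have "braking 0" using above_forever zero_in_H by blast
  then show thesis by (rule braking)
next
  case False
  then obtain r where r: "r \<in> H" "v r = e r" by auto
  have ne: "v 0 \<noteq> e 0" using assms by simp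
  have r0: "0 \<le> r" using r by (auto simp: horizon_def)
  obtain b where b: "b \<le> r" "0 < b" "v b = e b" "\<And>x. 0 \<le> x \<Longrightarrow> x < b \<Longrightarrow> v x \<noteq> e x"
    using contact_right[OF zero_in_H r(1) r0 r(2) ne] by metis
  have bH: "b \<in> H" using in_H_between[of 0 r b] b r zero_in_H by auto
  have "\<not> v x < e x" if "0 \<le> x" "x < b" for x
    using sign_constant[of 0 x] b(4) in_H_between[of 0 b x] that assms bH zero_in_H by force
  then have "e x < v x" if "0 \<le> x" "x < b" for x
    using b(4)[of x] that by force
  then have "v x = v 0 - \<beta> * x" if "0 \<le> x" "x \<le> b" for x
    using above_between_decel[of 0 b x] that b bH zero_in_H by auto
  then show thesis using contact bH b by blast
qed

end

section \<open>Phase decompositions\<close>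

text \<open>Extended-real ends allow the last piece to end at an infinite \<open>q\<close>; the
  intersection with the horizon drops the endpoint \<open>q\<close>. Consecutive segments share
  their switching time.\<close>

definition segment :: "ereal \<Rightarrow> ereal \<Rightarrow> ereal \<Rightarrow> real set" where
  "segment q a b = {t \<in> horizon q. a \<le> ereal t \<and> ereal t \<le> b}"

lemma is_interval_segment: "is_interval (segment q a b)"
  unfolding is_interval_1
proof (intro ballI allI impI)
  fix x y z assume "x \<in> segment q a b" "y \<in> segment q a b" "x \<le> z \<and> z \<le> y"
  then have "z \<in> horizon q" "ereal x \<le> ereal z" "ereal z \<le> ereal y" "a \<le> ereal x" "ereal y \<le> b"
    using horizon_Icc_subset[of x q y] by (auto simp: segment_def)
  then show "z \<in> segment q a b"
    unfolding segment_def using order_trans[of a "ereal x" "ereal z"] order_trans[of "ereal z" "ereal y" b] by simp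
qed

lemma segment_mono: "a \<le> a' \<Longrightarrow> b' \<le> b \<Longrightarrow> segment q a' b' \<subseteq> segment q a b"
  by (auto simp: segment_def intro: order_trans)

lemma segment_Un: "a \<le> b \<Longrightarrow> b \<le> c \<Longrightarrow> segment q a b \<union> segment q b c = segment q a c"
  by (auto simp: segment_def intro: order_trans)

lemma segment_nondegenerate:
  assumes "0 \<le> a" "a < b" "b \<le> q"
  obtains s t where "s \<in> segment q a b" "t \<in> segment q a b" "s < t"
proof -
  obtain s where s: "a < ereal s" "ereal s < b" using ereal_dense2[OF assms(2)] by blast
  obtain t where t: "ereal s < ereal t" "ereal t < b" using ereal_dense2[OF s(2)] by blast
  have "0 \<le> ereal s" using order_trans[OF assms(1) less_imp_le[OF s(1)]] .
  moreover have "ereal s < q" "ereal t < q"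
    using less_le_trans[OF s(2) assms(3)] less_le_trans[OF t(2) assms(3)] .
  moreover have "0 \<le> s" "0 \<le> t" using \<open>0 \<le> ereal s\<close> t by (auto simp: zero_ereal_def)
  ultimately show thesis
    using s t by (intro that[of s t]) (auto simp: segment_def horizon_def intro: less_imp_le order_trans)
qed

lemma horizon_real_of_ereal:
  assumes "0 \<le> a" "a < q"
  obtains r where "a = ereal r" "r \<in> horizon q"
  using assms by (cases a) (auto simp: horizon_def)

context lipschitz_path
begin

abbreviation typed :: "real set \<Rightarrow> phase_type \<Rightarrow> bool" where
  "typed \<equiv> has_type \<alpha> \<beta> vmax f F v"

abbreviation seg :: "ereal \<Rightarrow> ereal \<Rightarrow> real set" where
  "seg \<equiv> segment q"

lemma typed_mono: "typed J p \<Longrightarrow> K \<subseteq> J \<Longrightarrow> typed K p"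
  by (cases p) (auto; blast)+

lemma EL_curve_inject: "x \<in> H \<Longrightarrow> E B x = E B' x \<Longrightarrow> B = B'"
  using f_pos[of x] by (simp add: EL_curve_def)

text \<open>Each type has at most one free constant, an intercept or \<open>B\<close>, and one
  common time determines it. For \<open>B\<close> this is so because curves with different
  parameters never meet.\<close>

lemma typed_Un:
  assumes "typed J p" "typed K p" "x \<in> J" "x \<in> K" "x \<in> H"
  shows "typed (J \<union> K) p"
proof (cases p)
  case Accel
  then obtain c c' where "\<forall>t\<in>J. v t = c + \<alpha> * t" "\<forall>t\<in>K. v t = c' + \<alpha> * t" using assms by auto
  moreover from this have "c = c'" using assms by auto
  ultimately show ?thesis using Accel by auto
next
  case Decel
  then obtain c c' where "\<forall>t\<in>J. v t = c - \<beta> * t" "\<forall>t\<in>K. v t = c' - \<beta> * t" using assms by auto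
  moreover from this have "c = c'" using assms by auto
  ultimately show ?thesis using Decel by auto
next
  case EL
  then obtain c c' where "\<forall>t\<in>J. v t = E c t" "\<forall>t\<in>K. v t = E c' t" using assms by auto
  moreover from this have "c = c'" using assms EL_curve_inject[of x c c'] by auto
  ultimately show ?thesis using EL by auto
qed (use assms in auto)

text \<open>Direction of motion and end values separate all pairs except braking and following a
  curve, which both decrease. A curve of slope -\<beta> would keep
  \<open>E B x + \<beta> * x\<close> constant, against \<open>EL_curve_steep\<close>. That lemma
  needs two times for the missing rise and a third one for the strict fall, hence the midpoint
  \<open>m\<close>.\<close>

lemma typed_unique:
  assumes "s \<in> J" "t \<in> J" "s < t" "J \<subseteq> H" "is_interval J" "typed J p" "typed J p'"
  shows "p = p'"
proof -
  define m where "m = (s + t) / 2"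
  have "s < m" "m < t" using assms(3) by (simp_all add: m_def)
  then have m: "s < m" "m < t" "m \<in> J"
    using mem_is_interval_1_I[OF assms(5,1,2), of m] by auto
  have H: "s \<in> H" "m \<in> H" "t \<in> H" using assms m by auto
  have A: "v s < v t" if "typed J Accel"
    using that assms(1-3) \<alpha>_pos by auto
  have D: "v s = v t + \<beta> * (t - s) \<and> v m = v t + \<beta> * (t - m) \<and> v t < v s" if "typed J Decel"
  proof -
    from that obtain c where "\<And>x. x \<in> J \<Longrightarrow> v x = c - \<beta> * x"
      unfolding has_type.simps by blast
    then have "v s = c - \<beta> * s" "v t = c - \<beta> * t" "v m = c - \<beta> * m" using assms(1,2) m(3) by blast+
    moreover have "\<beta> * s < \<beta> * t" using assms(3) \<beta>_pos by simp
    ultimately show ?thesis by (simp add: algebra_simps)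
  qed
  have C: "v s = vmax \<and> v t = vmax" if "typed J Cruise"
    using that assms(1,2) by simp
  have Z: "v s = 0 \<and> v t = 0" if "typed J Halt"
    using that assms(1,2) by simp
  have EL: "v t < v s \<and> \<not> (v s = v t + \<beta> * (t - s) \<and> v m = v t + \<beta> * (t - m))" if EL: "typed J EL"
  proof -
    obtain B where B: "\<And>x. x \<in> J \<Longrightarrow> v x = E B x" using EL by auto
    have "v t < v s"
      using EL_curve_decreasing[of s t B] v_le[of s] H assms(1-3) B by auto
    moreover have "\<not> (v s = v t + \<beta> * (t - s) \<and> v m = v t + \<beta> * (t - m))"
    proof
      assume "v s = v t + \<beta> * (t - s) \<and> v m = v t + \<beta> * (t - m)"
      then have "E B s + \<beta> * s = E B t + \<beta> * t" "E B m + \<beta> * m = E B t + \<beta> * t"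
        using B assms(1,2) m by (simp_all add: algebra_simps)
      then show False using EL_curve_steep[of s m B t m] H m by auto
    qed
    ultimately show ?thesis by blast
  qed
  show ?thesis
    using A D C Z EL assms(6,7) vmax_pos by (cases p; cases p') force+
qed

lemma typed_seg_unique:
  assumes "0 \<le> a" "a < b" "b \<le> q" "typed J p" "typed J' p'" "seg a b \<subseteq> J" "seg a b \<subseteq> J'"
  shows "p = p'"
proof -
  obtain s t where "s \<in> seg a b" "t \<in> seg a b" "s < t"
    using segment_nondegenerate assms by metis
  then show ?thesis
    using typed_unique[of s "seg a b" t p p'] typed_mono assms is_interval_segment
    by (auto simp: segment_def)
qed

section \<open>Coverings of the horizon by typed pieces, and their uniqueness\<close>

fun covers :: "ereal \<Rightarrow> phase_type list \<Rightarrow> bool" where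
  "covers a [] \<longleftrightarrow> a = q"
| "covers a (p # ps) \<longleftrightarrow> (\<exists>b. a < b \<and> typed (seg a b) p \<and> covers b ps)"

text \<open>Pieces may be empty, and an empty piece imposes nothing. This lets all cases of the
  geometric analysis end in a few fixed words instead of one word for each combination of phases
  that occur.\<close>

fun weak_covers :: "ereal \<Rightarrow> phase_type list \<Rightarrow> bool" where
  "weak_covers a [] \<longleftrightarrow> a = q"
| "weak_covers a (p # ps) \<longleftrightarrow> (\<exists>b. a \<le> b \<and> (a < b \<longrightarrow> typed (seg a b) p) \<and> weak_covers b ps)"

lemma covers_le: "covers a ps \<Longrightarrow> a \<le> q"
  by (induction ps arbitrary: a) (auto dest: less_imp_le intro: order_trans)

lemma weak_covers_subseq: "weak_covers a ts \<Longrightarrow> \<exists>ps \<in> set (List.subseqs ts). covers a ps"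
proof (induction ts arbitrary: a)
  case (Cons p ts)
  then obtain b where b: "a \<le> b" "a < b \<longrightarrow> typed (seg a b) p" "weak_covers b ts" by auto
  from Cons.IH[OF b(3)] obtain ps where ps: "ps \<in> set (List.subseqs ts)" "covers b ps" by blast
  show ?case
  proof (cases "a = b")
    case True
    then show ?thesis using ps by (auto simp: Let_def)
  next
    case False
    then have "a < b" using b(1) by simp
    then have "covers a (p # ps)" using b ps by auto
    moreover have "p # ps \<in> set (List.subseqs (p # ts))" using ps by (simp add: Let_def)
    ultimately show ?thesis by blast
  qed
qed simp

lemma weak_covers_skip: "weak_covers a ts \<Longrightarrow> weak_covers a (p # ts)"
  by auto

lemma covers_merge:
  assumes "0 \<le> a" "covers a (p # p # ps)"
  shows "covers a (p # ps)"
proof -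
  obtain b c where b: "a < b" "typed (seg a b) p" "b < c" "typed (seg b c) p" "covers c ps"
    using assms by auto
  have "0 \<le> b" "b < q" using b assms covers_le[of c ps] by auto
  then obtain r where r: "b = ereal r" "r \<in> H" by (rule horizon_real_of_ereal)
  have "typed (seg a b \<union> seg b c) p"
    using b r by (intro typed_Un[of _ _ _ r]) (auto simp: segment_def)
  then have "typed (seg a c) p" using segment_Un[of a b c q] b by auto
  moreover have "a < c" using b by auto
  ultimately show ?thesis using b(5) by auto
qed

text \<open>Deleting an empty curve piece can leave two braking pieces next to each other; they form
  one phase.\<close>

lemma covers_remdups_adj:
  assumes "0 \<le> a" "covers a ps"
  shows "covers a (remdups_adj ps)"
  using assms
proof (induction ps arbitrary: a rule: remdups_adj.induct)
  case (3 x y xs)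
  show ?case
  proof (cases "x = y")
    case True
    then show ?thesis using 3 covers_merge[of a x xs] by auto
  next
    case False
    obtain b where b: "a < b" "typed (seg a b) x" "covers b (y # xs)" using 3 by auto
    then have "covers b (remdups_adj (y # xs))" using 3 False by auto
    then show ?thesis using b False by auto
  qed
qed auto

lemma covers_end_le:
  assumes "0 \<le> a" "a < b" "covers b ps" "distinct_adj (p # ps)" "typed (seg a b') p" "b' \<le> q"
  shows "b' \<le> b"
proof (rule ccontr)
  assume "\<not> b' \<le> b"
  then obtain p2 ps2 where ps: "ps = p2 # ps2" using assms by (cases ps) auto
  obtain c where c: "b < c" "typed (seg b c) p2" using assms(3) ps by auto
  \<comment> \<open>Past \<open>b\<close>, the longer first piece and the next piece overlap in a
    nondegenerate segment, which has only one type.\<close>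
  have "p2 = p"
    using c assms \<open>\<not> b' \<le> b\<close>
    by (intro typed_seg_unique[of b "min b' c" "seg b c" p2 "seg a b'" p] segment_mono)
      (auto simp: min_le_iff_disj)
  then show False using assms ps by simp
qed

text \<open>The theorem speaks about every phase sequence of \<open>v\<close>; this reduces it to
  the one that is constructed.\<close>

lemma covers_unique:
  assumes "0 \<le> a" "covers a ps" "covers a ps'" "distinct_adj ps" "distinct_adj ps'"
  shows "ps = ps'"
  using assms
proof (induction ps arbitrary: a ps')
  case Nil
  then show ?case using covers_le by (cases ps') force+
next
  case (Cons p ps)
  obtain b where b: "a < b" "typed (seg a b) p" "covers b ps" using Cons.prems by auto
  have "b \<le> q" using covers_le b by blast
  then obtain p' qs where ps': "ps' = p' # qs" using Cons.prems b by (cases ps') auto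
  obtain b' where b': "a < b'" "typed (seg a b') p'" "covers b' qs" using Cons.prems ps' by auto
  have "b' \<le> q" using covers_le b' by blast
  have "p = p'"
    using b b' \<open>b \<le> q\<close> Cons.prems(1)
    by (intro typed_seg_unique[of a "min b b'" "seg a b" p "seg a b'" p'] segment_mono) (auto simp: min_le_iff_disj)
  have "b = b'"
    using covers_end_le[of a b ps p b'] covers_end_le[of a b' qs p b] b b' \<open>b \<le> q\<close> \<open>b' \<le> q\<close> \<open>p = p'\<close> ps' Cons.prems
    by auto
  have "ps = qs"
  proof (rule Cons.IH[of b])
    show "0 \<le> b" using b(1) Cons.prems(1) by simp
    show "distinct_adj ps" "distinct_adj qs" using ps' Cons.prems by (auto dest: distinct_adj_ConsD)
  qed (use b b' \<open>b = b'\<close> in auto)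
  then show ?case using \<open>p = p'\<close> ps' by simp
qed

lemma covers_conv_nth:
  "covers a ps \<longleftrightarrow>
     (\<exists>\<tau> :: nat \<Rightarrow> ereal. \<tau> 0 = a \<and> \<tau> (length ps) = q \<and>
        (\<forall>i < length ps. \<tau> i < \<tau> (Suc i) \<and> typed (seg (\<tau> i) (\<tau> (Suc i))) (ps ! i)))"
proof (induction ps arbitrary: a)
  case (Cons p ps)
  show ?case
  proof
    assume "covers a (p # ps)"
    then obtain b where b: "a < b" "typed (seg a b) p" "covers b ps" by auto
    then obtain \<tau> :: "nat \<Rightarrow> ereal" where t: "\<tau> 0 = b" "\<tau> (length ps) = q"
      "\<forall>i < length ps. \<tau> i < \<tau> (Suc i) \<and> typed (seg (\<tau> i) (\<tau> (Suc i))) (ps ! i)"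
      using Cons by blast
    show "\<exists>\<tau> :: nat \<Rightarrow> ereal. \<tau> 0 = a \<and> \<tau> (length (p # ps)) = q \<and>
        (\<forall>i < length (p # ps). \<tau> i < \<tau> (Suc i) \<and> typed (seg (\<tau> i) (\<tau> (Suc i))) ((p # ps) ! i))"
      using t b by (intro exI[of _ "case_nat a \<tau>"]) (auto simp: less_Suc_eq_0_disj)
  next
    assume "\<exists>\<tau> :: nat \<Rightarrow> ereal. \<tau> 0 = a \<and> \<tau> (length (p # ps)) = q \<and>
        (\<forall>i < length (p # ps). \<tau> i < \<tau> (Suc i) \<and> typed (seg (\<tau> i) (\<tau> (Suc i))) ((p # ps) ! i))"
    then obtain \<tau> :: "nat \<Rightarrow> ereal" where t: "\<tau> 0 = a" "\<tau> (length (p # ps)) = q"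
      "\<And>i. i < length (p # ps) \<Longrightarrow> \<tau> i < \<tau> (Suc i) \<and> typed (seg (\<tau> i) (\<tau> (Suc i))) ((p # ps) ! i)"
      by blast
    have "covers (\<tau> (Suc 0)) ps"
      unfolding Cons using t(2) t(3)[of "Suc _"] by (intro exI[of _ "\<lambda>i. \<tau> (Suc i)"]) auto
    then show "covers a (p # ps)" using t(1) t(3)[of 0] by auto
  qed
qed auto

lemma chain_le:
  fixes \<tau> :: "nat \<Rightarrow> ereal"
  assumes "\<And>i. i < n \<Longrightarrow> \<tau> i < \<tau> (Suc i)" "i \<le> j" "j \<le> n"
  shows "\<tau> i \<le> \<tau> j"
  using assms(2,3)
proof (induction j rule: dec_induct)
  case (step k)
  then show ?case using assms(1)[of k] by (auto intro: order_trans less_imp_le)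
qed simp

lemma phase_sequence_altdef:
  "phase_sequence \<alpha> \<beta> vmax q f F v ps \<longleftrightarrow>
     (\<exists>\<tau> :: nat \<Rightarrow> ereal. \<tau> 0 = 0 \<and> \<tau> (length ps) = q \<and>
        (\<forall>i < length ps. \<tau> i < \<tau> (Suc i) \<and>
           is_phase \<alpha> \<beta> vmax q f F v (seg (\<tau> i) (\<tau> (Suc i))) (ps ! i)))"
  unfolding phase_sequence_def segment_def ..

lemma phase_sequence_covers:
  assumes "phase_sequence \<alpha> \<beta> vmax q f F v ps"
  shows "covers 0 ps" "distinct_adj ps"
proof -
  obtain \<tau> :: "nat \<Rightarrow> ereal" where t: "\<tau> 0 = 0" "\<tau> (length ps) = q"
    "\<And>i. i < length ps \<Longrightarrow> \<tau> i < \<tau> (Suc i)"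
    "\<And>i. i < length ps \<Longrightarrow> is_phase \<alpha> \<beta> vmax q f F v (seg (\<tau> i) (\<tau> (Suc i))) (ps ! i)"
    using assms unfolding phase_sequence_altdef by blast
  have typed: "typed (seg (\<tau> i) (\<tau> (Suc i))) (ps ! i)" if "i < length ps" for i
    using t(4)[OF that] by (auto simp: is_phase_def)
  then show "covers 0 ps" unfolding covers_conv_nth using t by blast
  show "distinct_adj ps"
    unfolding distinct_adj_conv_nth
  proof (intro allI impI notI)
    fix i assume i: "Suc i < length ps" "ps ! i = ps ! Suc i"
    have "0 \<le> \<tau> (Suc i)" using chain_le[of "length ps" \<tau> 0 "Suc i"] t i by auto
    moreover have "\<tau> (Suc (Suc i)) \<le> q"
      using chain_le[of "length ps" \<tau> "Suc (Suc i)" "length ps"] t i by auto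
    then have "\<tau> (Suc i) < q" using t(3)[of "Suc i"] i by auto
    ultimately obtain r where r: "\<tau> (Suc i) = ereal r" "r \<in> H" by (rule horizon_real_of_ereal)
    let ?J = "seg (\<tau> i) (\<tau> (Suc i))" and ?K = "seg (\<tau> (Suc i)) (\<tau> (Suc (Suc i)))"
    have lt: "\<tau> i < \<tau> (Suc i)" "\<tau> (Suc i) < \<tau> (Suc (Suc i))" using t(3) i by auto
    \<comment> \<open>Two neighbours of one type agree at the shared switching time, so their union
      would extend the first one, against its maximality.\<close>
    have "typed (?J \<union> ?K) (ps ! i)"
      using typed[of i] typed[of "Suc i"] i r lt by (intro typed_Un[of _ _ _ r]) (auto simp: segment_def)
    moreover have "?J \<union> ?K = seg (\<tau> i) (\<tau> (Suc (Suc i)))" using lt by (intro segment_Un) auto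
    moreover have "\<forall>K. ?J \<subseteq> K \<and> K \<subseteq> H \<and> is_interval K \<and> typed K (ps ! i) \<longrightarrow> K = ?J"
      using t(4)[OF Suc_lessD[OF i(1)]] unfolding is_phase_def by blast
    moreover have "?J \<union> ?K \<subseteq> H" by (auto simp: segment_def)
    ultimately have "?J \<union> ?K = ?J"
      using is_interval_segment by (metis Un_upper1)
    then have "?K \<subseteq> ?J" by blast
    obtain x y where xy: "x \<in> ?K" "y \<in> ?K" "x < y"
      using segment_nondegenerate[OF \<open>0 \<le> \<tau> (Suc i)\<close> lt(2) \<open>\<tau> (Suc (Suc i)) \<le> q\<close>] by blast
    then have "ereal y \<le> \<tau> (Suc i)" "\<tau> (Suc i) \<le> ereal x"
      using \<open>?K \<subseteq> ?J\<close> by (auto simp: segment_def)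
    then have "ereal y \<le> ereal x" by (rule order_trans)
    then show False using \<open>x < y\<close> by simp
  qed
qed

text \<open>Maximality is automatic: a larger interval of the same type would reach into a
  neighbouring piece and give it a second type on a nondegenerate interval.\<close>

lemma covers_phase_sequence:
  assumes "covers 0 ps" "distinct_adj ps"
  shows "phase_sequence \<alpha> \<beta> vmax q f F v ps"
proof -
  obtain \<tau> :: "nat \<Rightarrow> ereal" where t: "\<tau> 0 = 0" "\<tau> (length ps) = q"
    "\<And>i. i < length ps \<Longrightarrow> \<tau> i < \<tau> (Suc i)"
    "\<And>i. i < length ps \<Longrightarrow> typed (seg (\<tau> i) (\<tau> (Suc i))) (ps ! i)"
    using assms unfolding covers_conv_nth by blast
  have nonneg: "0 \<le> \<tau> i" if "i \<le> length ps" for i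
    using chain_le[of "length ps" \<tau> 0 i] t that by auto
  have le_q: "\<tau> i \<le> q" if "i \<le> length ps" for i
    using chain_le[of "length ps" \<tau> i "length ps"] t that by auto
  have "is_phase \<alpha> \<beta> vmax q f F v (seg (\<tau> i) (\<tau> (Suc i))) (ps ! i)" if i: "i < length ps" for i
    unfolding is_phase_def
  proof (intro conjI allI impI)
    show "seg (\<tau> i) (\<tau> (Suc i)) \<subseteq> H" by (auto simp: segment_def)
    show "is_interval (seg (\<tau> i) (\<tau> (Suc i)))" by (rule is_interval_segment)
    show "typed (seg (\<tau> i) (\<tau> (Suc i))) (ps ! i)" using t i by blast
    have lt: "\<tau> i < \<tau> (Suc i)" using t i by blast
    show "\<exists>x\<in>seg (\<tau> i) (\<tau> (Suc i)). \<exists>y\<in>seg (\<tau> i) (\<tau> (Suc i)). x < y"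
    proof -
      have "0 \<le> \<tau> i" "\<tau> (Suc i) \<le> q" using nonneg[of i] le_q[of "Suc i"] i by auto
      then show ?thesis using segment_nondegenerate[OF _ lt] by metis
    qed
    fix K assume K: "seg (\<tau> i) (\<tau> (Suc i)) \<subseteq> K \<and> K \<subseteq> H \<and> is_interval K \<and> typed K (ps ! i)"
    have sub: "seg (ereal a) (ereal b) \<subseteq> K" if "a \<in> K" "b \<in> K" for a b
      using mem_is_interval_1_I[of K a b] K that by (auto simp: segment_def)
    have "x \<in> seg (\<tau> i) (\<tau> (Suc i))" if x: "x \<in> K" for x
    proof (rule ccontr)
      assume "x \<notin> seg (\<tau> i) (\<tau> (Suc i))"
      moreover have xH: "x \<in> H" using x K by blast
      ultimately consider "\<tau> (Suc i) < ereal x" | "ereal x < \<tau> i" by (auto simp: segment_def)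
      then show False
      proof cases
        case 1
        have xq: "ereal x < q" using xH by (simp add: horizon_def)
        then have "\<tau> (Suc i) < q" using 1 by auto
        then have i2: "Suc i < length ps" using t(2) i by (metis Suc_lessI order_less_irrefl)
        obtain r where r: "\<tau> (Suc i) = ereal r" "r \<in> H"
          using horizon_real_of_ereal[OF nonneg \<open>\<tau> (Suc i) < q\<close>] i by auto
        then have "r \<in> K" using K lt by (auto simp: segment_def)
        then have "seg (\<tau> (Suc i)) (ereal x) \<subseteq> K" using sub x r by auto
        then have "ps ! i = ps ! Suc i"
          using t(3)[OF i2] t(4)[OF i2] K 1 nonneg[of "Suc i"] i2 xq
          by (intro typed_seg_unique[of "\<tau> (Suc i)" "min (ereal x) (\<tau> (Suc (Suc i)))" K _ "seg (\<tau> (Suc i)) (\<tau> (Suc (Suc i)))"])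
            (auto simp: min_le_iff_disj segment_def)
        then show False using assms(2) i2 by (simp add: distinct_adj_conv_nth)
      next
        case 2
        then have "0 < i" using t(1) xH by (cases i) (auto simp: horizon_def simp flip: zero_ereal_def)
        then obtain j where j: "i = Suc j" by (cases i) auto
        have "\<tau> i < q" using lt le_q[of "Suc i"] i by auto
        then obtain r where r: "\<tau> i = ereal r" "r \<in> H"
          using horizon_real_of_ereal[OF nonneg[of i]] i by auto
        then have "r \<in> K" using K lt by (auto simp: segment_def)
        then have "seg (ereal x) (\<tau> i) \<subseteq> K" using sub x r by auto
        then have "ps ! i = ps ! j"
          using t(3)[of j] t(4)[of j] K 2 nonneg[of j] i j \<open>\<tau> i < q\<close>
          by (intro typed_seg_unique[of "max (ereal x) (\<tau> j)" "\<tau> i" K _ "seg (\<tau> j) (\<tau> i)"])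
            (auto simp: le_max_iff_disj segment_def)
        then show False using distinct_adj_nth[OF assms(2), of j] i j by simp
      qed
    qed
    then show "K = seg (\<tau> i) (\<tau> (Suc i))" using K by blast
  qed
  then show ?thesis unfolding phase_sequence_altdef using t by blast
qed

lemma covers_append: "covers a (ps @ qs) \<Longrightarrow> \<exists>b. a \<le> b \<and> covers b qs"
proof (induction ps arbitrary: a)
  case (Cons p ps)
  then obtain b where "a < b" "covers b (ps @ qs)" by auto
  with Cons.IH[of b] show ?case by (auto dest: less_imp_le intro: order_trans)
qed auto

text \<open>The pieces share the switching time, where the velocity is 0. Cruising would make it
  \<open>vmax\<close>, and accelerating up to 0 would need a negative velocity before.\<close>

lemma covers_before_halt:
  assumes "0 \<le> a" "covers a (ps @ [p, Halt])"
  shows "p \<noteq> Accel" "p \<noteq> Cruise"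
proof -
  obtain a' where a': "a \<le> a'" "covers a' [p, Halt]" using covers_append assms by blast
  then obtain b where b: "a' < b" "typed (seg a' b) p" "b < q" "typed (seg b q) Halt" by auto
  have "0 \<le> a'" "a' < q" "0 \<le> b" using assms a' b by auto
  obtain r where r: "a' = ereal r" "r \<in> H"
    using horizon_real_of_ereal[OF \<open>0 \<le> a'\<close> \<open>a' < q\<close>] .
  obtain s where s: "b = ereal s" "s \<in> H"
    using horizon_real_of_ereal[OF \<open>0 \<le> b\<close> \<open>b < q\<close>] .
  have in1: "r \<in> seg a' b" "s \<in> seg a' b" "s \<in> seg b q" using r s b by (auto simp: segment_def)
  have "r < s" using r s b by simp
  have "v s = 0" using b in1 by auto
  show "p \<noteq> Cruise" using b in1 \<open>v s = 0\<close> vmax_pos by auto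
  show "p \<noteq> Accel"
  proof
    assume "p = Accel"
    then have "v s - v r = \<alpha> * (s - r)" using b in1 by (auto simp: algebra_simps)
    then show False using \<open>v s = 0\<close> v_nonneg[OF r(2)] \<open>r < s\<close> \<alpha>_pos
      by (smt (verit) mult_pos_pos)
  qed
qed

section \<open>From explicit shapes to words of phase types\<close>

lemma braking_covers:
  assumes "c \<in> H" "\<And>x. x \<in> H \<Longrightarrow> c \<le> x \<Longrightarrow> v x = max (v c - \<beta> * (x - c)) 0"
  shows "weak_covers (ereal c) [Decel, Halt]"
    and "v c = 0 \<Longrightarrow> weak_covers (ereal c) [Halt]"
proof -
  have cq: "ereal c < q" using assms(1) by (simp add: horizon_def)
  \<comment> \<open>The time at which braking reaches velocity 0, or \<open>q\<close> if the horizon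
    ends first; in the latter case the final piece is empty.\<close>
  define b where "b = min q (ereal (c + v c / \<beta>))"
  have cb: "ereal c \<le> b" using cq v_nonneg[OF assms(1)] \<beta>_pos by (auto simp: b_def)
  have "typed (seg (ereal c) b) Decel"
  proof -
    have "v x = (v c + \<beta> * c) - \<beta> * x" if "x \<in> seg (ereal c) b" for x
    proof -
      have x: "x \<in> H" "c \<le> x" "x \<le> c + v c / \<beta>" using that by (auto simp: segment_def b_def)
      then have "\<beta> * (x - c) \<le> v c" using \<beta>_pos by (simp add: field_simps)
      then show ?thesis using assms(2)[OF x(1,2)] by (simp add: algebra_simps)
    qed
    then show ?thesis by auto
  qed
  moreover have "typed (seg b q) Halt" if "b < q"
  proof -
    have "v x = 0" if "x \<in> seg b q" for x
    proof -
      have x: "x \<in> H" "c + v c / \<beta> \<le> x" using that \<open>b < q\<close> by (auto simp: segment_def b_def min_def split: if_splits)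
      moreover have "c \<le> x" using x v_nonneg[OF assms(1)] \<beta>_pos by (smt (verit) divide_nonneg_pos)
      moreover have "v c \<le> \<beta> * (x - c)" using x \<beta>_pos by (simp add: field_simps)
      ultimately show ?thesis using assms(2)[of x] by simp
    qed
    then show ?thesis by simp
  qed
  moreover have "b \<le> q" by (simp add: b_def)
  ultimately show "weak_covers (ereal c) [Decel, Halt]"
    using cb by auto
  show "weak_covers (ereal c) [Halt]" if "v c = 0"
  proof -
    have "v x = 0" if "x \<in> seg (ereal c) q" for x
      using that assms(2)[of x] \<open>v c = 0\<close> \<beta>_pos by (auto simp: segment_def)
    then show ?thesis using cq by auto
  qed
qed

lemma accel_cruise_covers:
  assumes "0 \<le> s" "s \<le> q" "\<And>x. x \<in> seg 0 s \<Longrightarrow> v x = min (v 0 + \<alpha> * x) vmax" "weak_covers s ps"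
  shows "weak_covers 0 (Accel # Cruise # ps)"
proof -
  \<comment> \<open>The time at which acceleration reaches \<open>vmax\<close>, cut off at
    \<open>s\<close>.\<close>
  define b where "b = min s (ereal ((vmax - v 0) / \<alpha>))"
  have "0 \<le> b" using assms(1) v_le[OF zero_in_H] \<alpha>_pos by (auto simp: b_def)
  moreover have "b \<le> s" by (simp add: b_def)
  moreover have "typed (seg 0 b) Accel"
  proof -
    have "v x = v 0 + \<alpha> * x" if "x \<in> seg 0 b" for x
    proof -
      have x: "x \<in> seg 0 s" "x \<le> (vmax - v 0) / \<alpha>" using that by (auto simp: segment_def b_def)
      then show ?thesis using assms(3)[OF x(1)] \<alpha>_pos by (simp add: field_simps)
    qed
    then show ?thesis by auto
  qed
  moreover have "typed (seg b s) Cruise" if "b < s"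
  proof -
    have "v x = vmax" if x: "x \<in> seg b s" for x
    proof -
      have "x \<in> seg 0 s" using x segment_mono[of 0 b s s q] \<open>0 \<le> b\<close> by auto
      moreover have "(vmax - v 0) / \<alpha> \<le> x"
        using x \<open>b < s\<close> by (auto simp: segment_def b_def min_def split: if_splits)
      ultimately show ?thesis using assms(3)[of x] \<alpha>_pos by (simp add: field_simps)
    qed
    then show ?thesis by simp
  qed
  ultimately show ?thesis using assms(4) by auto
qed

end

context el_path
begin

lemma contact_covers:
  assumes "r \<in> H" "v r = e r"
  shows "weak_covers (ereal r) [EL, Decel, Halt]"
    and "EL_never_steep \<Longrightarrow> weak_covers (ereal r) [EL, Halt]"
proof -
  have rq: "ereal r < q" using assms by (simp add: horizon_def)
  consider (EL) "\<And>x. x \<in> H \<Longrightarrow> r \<le> x \<Longrightarrow> v x = e x"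
  | (braking) c where "c \<in> H" "r \<le> c" "\<And>x. r \<le> x \<Longrightarrow> x \<le> c \<Longrightarrow> v x = e x"
      "braking c" "EL_never_steep \<Longrightarrow> v c = 0"
    using contact_structure[OF assms] by metis
  then have "weak_covers (ereal r) [EL, Decel, Halt] \<and> (EL_never_steep \<longrightarrow> weak_covers (ereal r) [EL, Halt])"
  proof cases
    case EL
    then have "typed (seg (ereal r) q) EL" by (auto simp: segment_def)
    then show ?thesis using rq by (auto intro!: exI[of _ q])
  next
    case (braking c)
    have "typed (seg (ereal r) (ereal c)) EL" using braking(3) by (auto simp: segment_def)
    moreover have "weak_covers (ereal c) [Decel, Halt]"
      "EL_never_steep \<Longrightarrow> weak_covers (ereal c) [Halt]"
      using braking_covers[OF braking(1)] braking(4,5) unfolding braking_def by blast+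
    moreover have "ereal r \<le> ereal c" using braking(2) by simp
    ultimately show ?thesis
      unfolding weak_covers.simps(2)[of "ereal r" EL] by blast
  qed
  then show "weak_covers (ereal r) [EL, Decel, Halt]"
    and "EL_never_steep \<Longrightarrow> weak_covers (ereal r) [EL, Halt]" by auto
qed

text \<open>The two words belong to starts below and above the curve. A start on the curve fits the
  first word with its accelerating and cruising pieces empty.\<close>

lemma path_structure:
  "weak_covers 0 [Accel, Cruise, EL, Decel, Halt] \<and>
     (EL_never_steep \<longrightarrow> weak_covers 0 [Accel, Cruise, EL, Halt]) \<or>
   weak_covers 0 [Decel, EL, Decel, Halt] \<and>
     (EL_never_steep \<longrightarrow> weak_covers 0 [Decel, EL, Halt] \<or> weak_covers 0 [Decel, Halt])"
proof -
  consider "v 0 < e 0" | "e 0 < v 0" | "v 0 = e 0" by linarith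
  then show ?thesis
  proof cases
    case 1
    consider (forever) "\<And>x. x \<in> H \<Longrightarrow> v x = min (v 0 + \<alpha> * x) vmax"
    | (contact) s where "s \<in> H" "\<And>x. 0 \<le> x \<Longrightarrow> x \<le> s \<Longrightarrow> v x = min (v 0 + \<alpha> * x) vmax" "v s = e s"
    | (braking) s where "s \<in> H" "\<And>x. 0 \<le> x \<Longrightarrow> x \<le> s \<Longrightarrow> v x = min (v 0 + \<alpha> * x) vmax"
      "braking s" "\<not> EL_never_steep"
      using start_below[OF 1] by metis
    then show ?thesis
    proof cases
      case forever
      have *: "weak_covers 0 (Accel # Cruise # ps)" if "weak_covers q ps" for ps
      proof (rule accel_cruise_covers[OF _ _ _ that])
        show "v x = min (v 0 + \<alpha> * x) vmax" if "x \<in> seg 0 q" for x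
          using forever[of x] that unfolding segment_def by blast
      qed (use q_pos in auto)
      have "weak_covers q [EL, Decel, Halt]" "weak_covers q [EL, Halt]" by auto
      then show ?thesis using * by blast
    next
      case (contact s)
      have *: "weak_covers 0 (Accel # Cruise # ps)" if "weak_covers (ereal s) ps" for ps
      proof (rule accel_cruise_covers[OF _ _ _ that])
        show "v x = min (v 0 + \<alpha> * x) vmax" if "x \<in> seg 0 (ereal s)" for x
          by (rule contact(2)) (use that in \<open>auto simp: segment_def\<close>)
      qed (use contact(1) in \<open>auto simp: horizon_def\<close>)
      then show ?thesis using contact_covers[OF contact(1,3)] by blast
    next
      case (braking s)
      have *: "weak_covers 0 (Accel # Cruise # ps)" if "weak_covers (ereal s) ps" for ps
      proof (rule accel_cruise_covers[OF _ _ _ that])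
        show "v x = min (v 0 + \<alpha> * x) vmax" if "x \<in> seg 0 (ereal s)" for x
          by (rule braking(2)) (use that in \<open>auto simp: segment_def\<close>)
      qed (use braking(1) in \<open>auto simp: horizon_def\<close>)
      have "weak_covers (ereal s) [Decel, Halt]"
        using braking_covers(1)[OF braking(1)] braking(3) unfolding braking_def by blast
      then show ?thesis using * weak_covers_skip braking(4) by blast
    qed
  next
    case 2
    consider (braking) "braking 0"
    | (contact) b where "b \<in> H" "\<And>x. 0 \<le> x \<Longrightarrow> x \<le> b \<Longrightarrow> v x = v 0 - \<beta> * x" "v b = e b"
      using start_above[OF 2] by metis
    then show ?thesis
    proof cases
      case braking
      have "weak_covers 0 [Decel, Halt]"
        using braking_covers(1)[OF zero_in_H] braking unfolding braking_def by (auto simp: zero_ereal_def)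
      moreover have "weak_covers 0 [Decel, EL, Decel, Halt]"
        using weak_covers_skip[OF weak_covers_skip[OF calculation]] .
      ultimately show ?thesis by blast
    next
      case (contact b)
      have "typed (seg 0 (ereal b)) Decel"
      proof -
        have "v x = v 0 - \<beta> * x" if "x \<in> seg 0 (ereal b)" for x
          by (rule contact(2)) (use that in \<open>auto simp: segment_def\<close>)
        then show ?thesis unfolding has_type.simps by blast
      qed
      moreover have "0 \<le> ereal b" using contact(1) by (simp add: horizon_def)
      ultimately have "weak_covers 0 (Decel # ps)" if "weak_covers (ereal b) ps" for ps
        using that weak_covers.simps(2) by blast
      then show ?thesis using contact_covers[OF contact(1,3)] by blast
    qed
  next
    case 3
    have "weak_covers 0 [EL, Decel, Halt]" "EL_never_steep \<Longrightarrow> weak_covers 0 [EL, Halt]"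
      using contact_covers[OF zero_in_H 3] by (simp_all only: zero_ereal_def)
    then show ?thesis using weak_covers_skip by blast
  qed
qed

end

section \<open>Variational inequality and multiplier\<close>

text \<open>A vanishing integral only yields equality almost everywhere. The set of disagreement is
  open, and a nonempty open set is not null.\<close>

lemma AE_eq_continuous_on_open:
  fixes g h :: "real \<Rightarrow> real"
  assumes "open S" "continuous_on S g" "continuous_on S h" "AE x in lborel. x \<in> S \<longrightarrow> g x = h x" "x \<in> S"
  shows "g x = h x"
proof (rule ccontr)
  assume "g x \<noteq> h x"
  define U where "U = S \<inter> (\<lambda>x. g x - h x) -` (- {0})"
  have "open U"
    unfolding U_def using assms by (intro continuous_open_preimage continuous_intros) auto
  moreover have "x \<in> U" using assms \<open>g x \<noteq> h x\<close> by (auto simp: U_def)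
  ultimately have "\<not> negligible U" using open_not_negligible[of U] by auto
  moreover have "AE x in lborel. x \<notin> U" using assms(4) by eventually_elim (auto simp: U_def)
  then have "U \<in> null_sets lborel" using \<open>open U\<close> by (subst AE_iff_null_sets) auto
  then have "negligible U" by (simp add: negligible_iff_null_sets null_sets_completionI)
  ultimately show False by simp
qed

lemma set_integral_nonpos_eq_0:
  fixes \<psi> :: "real \<Rightarrow> real"
  assumes "S \<in> sets lborel" "set_integrable lborel S \<psi>" "\<And>x. x \<in> S \<Longrightarrow> 0 \<le> \<psi> x" "(LINT x:S|lborel. \<psi> x) \<le> 0"
  shows "AE x in lborel. x \<in> S \<longrightarrow> \<psi> x = 0"
proof -
  have nn: "AE x in lborel. 0 \<le> indicator S x *\<^sub>R \<psi> x" using assms(3) by (auto simp: indicator_def)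
  have "0 \<le> (LINT x:S|lborel. \<psi> x)"
    unfolding set_lebesgue_integral_def using nn by (rule integral_nonneg_AE)
  then have "(LINT x|lborel. indicator S x *\<^sub>R \<psi> x) = 0" using assms(4) by (simp add: set_lebesgue_integral_def)
  then have "AE x in lborel. indicator S x *\<^sub>R \<psi> x = 0"
    using integral_nonneg_eq_0_iff_AE[OF assms(2)[unfolded set_integrable_def] nn] by blast
  then show ?thesis by eventually_elim auto
qed

lemma integrable_bounded_mult:
  fixes g h :: "real \<Rightarrow> real"
  assumes "integrable M h" "g \<in> borel_measurable M" "\<And>x. \<bar>g x\<bar> \<le> C"
  shows "integrable M (\<lambda>x. g x * h x)"
proof (rule Bochner_Integration.integrable_bound)
  show "integrable M (\<lambda>x. C * h x)" using assms by simp
  show "(\<lambda>x. g x * h x) \<in> borel_measurable M" using assms by simp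
  have "0 \<le> C" using assms(3)[of undefined] by linarith
  then show "AE x in M. norm (g x * h x) \<le> norm (C * h x)"
    using assms(3) by (auto simp: abs_mult intro!: mult_right_mono)
qed

lemma set_integrable_cmult:
  fixes g :: "_ \<Rightarrow> real"
  shows "set_integrable M A g \<Longrightarrow> set_integrable M A (\<lambda>t. c * g t)"
  using set_integrable_mult_right[of c M A g] by (cases "c = 0") (simp_all add: set_integrable_def)

lemma nonneg_from_quadratic:
  fixes a b :: real
  assumes "\<And>\<epsilon>. 0 < \<epsilon> \<Longrightarrow> \<epsilon> \<le> 1 \<Longrightarrow> 0 \<le> 2 * \<epsilon> * a + \<epsilon>\<^sup>2 * b"
  shows "0 \<le> a"
proof (rule ccontr)
  assume "\<not> 0 \<le> a"
  \<comment> \<open>With this choice \<open>\<epsilon> * b \<le> - a\<close>, so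
    \<open>2 * a + \<epsilon> * b \<le> a < 0\<close>.\<close>
  define \<epsilon> where "\<epsilon> = min 1 (- a / (\<bar>b\<bar> + 1))"
  have e: "0 < \<epsilon>" "\<epsilon> \<le> 1" using \<open>\<not> 0 \<le> a\<close> by (auto simp: \<epsilon>_def divide_neg_pos)
  have "\<epsilon> \<le> - a / (\<bar>b\<bar> + 1)" by (simp add: \<epsilon>_def)
  moreover have "0 < \<bar>b\<bar> + 1" by (simp add: add_nonneg_pos)
  ultimately have "\<epsilon> * (\<bar>b\<bar> + 1) \<le> - a" by (simp only: pos_le_divide_eq)
  moreover have "\<epsilon> * b \<le> \<epsilon> * (\<bar>b\<bar> + 1)" using e by (intro mult_left_mono) auto
  ultimately have "2 * a + \<epsilon> * b < 0" using \<open>\<not> 0 \<le> a\<close> by linarith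
  then have "\<epsilon> * (2 * a + \<epsilon> * b) < 0" using e by (simp add: mult_pos_neg)
  then show False using assms[OF e] by (simp add: algebra_simps power2_eq_square)
qed

text \<open>Applied with \<open>a\<close> the change of the total distance and \<open>b\<close> the first variation of the cost.\<close>

lemma lagrange_multiplier:
  fixes S :: "(real \<times> real) set"
  assumes conv: "convex S" and zero: "\<And>b. (0, b) \<in> S \<Longrightarrow> 0 \<le> b"
    and "(a1, b1) \<in> S" "0 < a1" "(a2, b2) \<in> S" "a2 < 0"
  obtains \<mu> where "\<And>a b. (a, b) \<in> S \<Longrightarrow> 0 \<le> b + \<mu> * a"
proof -
  \<comment> \<open>The segment joining points on opposite sides of the vertical axis crosses it at
    a nonnegative height, by \<open>zero\<close>. This orders the slope bounds imposed on
    \<open>\<mu>\<close> from the right and from the left; the weight \<open>t\<close> locates the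
    crossing.\<close>
  have cross: "- b / a \<le> - d / c" if "(a, b) \<in> S" "0 < a" "(c, d) \<in> S" "c < 0" for a b c d
  proof -
    define t where "t = - c / (a - c)"
    have t: "0 \<le> t" "0 \<le> 1 - t" using that by (auto simp: t_def field_simps)
    have "t *\<^sub>R (a, b) + (1 - t) *\<^sub>R (c, d) \<in> S"
      using convexD[OF conv that(1,3) t] by simp
    moreover have "t * a + (1 - t) * c = 0" using that by (simp add: t_def field_simps)
    ultimately have "0 \<le> t * b + (1 - t) * d" using zero by simp
    then have "0 \<le> (a - c) * (t * b + (1 - t) * d)" using that by (intro mult_nonneg_nonneg) auto
    also have "(a - c) * (t * b + (1 - t) * d) = ((a - c) * t) * b + ((a - c) * (1 - t)) * d"
      by (simp add: algebra_simps)
    also have "(a - c) * t = - c" using that by (simp add: t_def)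
    also have "(a - c) * (1 - t) = a" using that by (simp add: t_def field_simps)
    finally have "0 \<le> - c * b + a * d" .
    then show ?thesis using that by (simp add: field_simps)
  qed
  define R where "R = (\<lambda>(a, b). - b / a) ` {(a, b) \<in> S. 0 < a}"
  \<comment> \<open>Any number between the two families of bounds would serve. The point with
    \<open>0 < a1\<close> makes \<open>R\<close> nonempty, the one with \<open>a2 < 0\<close> bounds
    it.\<close>
  define \<mu> where "\<mu> = Sup R"
  have "R \<noteq> {}" using assms(3,4) by (force simp: R_def)
  have upper: "x \<le> - d / c" if "x \<in> R" "(c, d) \<in> S" "c < 0" for x c d
    using cross that by (auto simp: R_def)
  have "bdd_above R" using upper[OF _ assms(5,6)] by (auto simp: bdd_above_def)
  show thesis
  proof (rule that[of \<mu>])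
    fix a b assume ab: "(a, b) \<in> S"
    consider "0 < a" | "a < 0" | "a = 0" by linarith
    then show "0 \<le> b + \<mu> * a"
    proof cases
      case 1
      then have "- b / a \<in> R" using ab by (force simp: R_def)
      then have "- b / a \<le> \<mu>" unfolding \<mu>_def using \<open>bdd_above R\<close> by (rule cSup_upper)
      then show ?thesis using 1 by (simp add: field_simps)
    next
      case 2
      have "\<mu> \<le> - b / a" unfolding \<mu>_def using \<open>R \<noteq> {}\<close> upper[OF _ ab 2] by (rule cSup_least)
      then show ?thesis using 2 by (simp add: field_simps)
    qed (use zero ab in auto)
  qed
qed

section \<open>Lattice and convex operations on the Lipschitz class\<close>

lemma ab_lipschitz_max:
  assumes "ab_lipschitz \<alpha> \<beta> q g" "ab_lipschitz \<alpha> \<beta> q h"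
  shows "ab_lipschitz \<alpha> \<beta> q (\<lambda>x. max (g x) (h x))"
  unfolding ab_lipschitz_def
proof (intro ballI impI)
  fix s t assume "s \<in> horizon q" "t \<in> horizon q" "s \<le> t"
  then have "- \<beta> * (t - s) \<le> g t - g s \<and> g t - g s \<le> \<alpha> * (t - s)"
    "- \<beta> * (t - s) \<le> h t - h s \<and> h t - h s \<le> \<alpha> * (t - s)"
    using assms unfolding ab_lipschitz_def by blast+
  then show "- \<beta> * (t - s) \<le> max (g t) (h t) - max (g s) (h s) \<and>
      max (g t) (h t) - max (g s) (h s) \<le> \<alpha> * (t - s)"
    by linarith
qed

lemma ab_lipschitz_min:
  assumes "ab_lipschitz \<alpha> \<beta> q g" "ab_lipschitz \<alpha> \<beta> q h"
  shows "ab_lipschitz \<alpha> \<beta> q (\<lambda>x. min (g x) (h x))"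
  unfolding ab_lipschitz_def
proof (intro ballI impI)
  fix s t assume "s \<in> horizon q" "t \<in> horizon q" "s \<le> t"
  then have "- \<beta> * (t - s) \<le> g t - g s \<and> g t - g s \<le> \<alpha> * (t - s)"
    "- \<beta> * (t - s) \<le> h t - h s \<and> h t - h s \<le> \<alpha> * (t - s)"
    using assms unfolding ab_lipschitz_def by blast+
  then show "- \<beta> * (t - s) \<le> min (g t) (h t) - min (g s) (h s) \<and>
      min (g t) (h t) - min (g s) (h s) \<le> \<alpha> * (t - s)"
    by linarith
qed

lemma ab_lipschitz_affine:
  assumes "- \<beta> \<le> m" "m \<le> \<alpha>"
  shows "ab_lipschitz \<alpha> \<beta> q (\<lambda>x. c + m * x)"
  unfolding ab_lipschitz_def
proof (intro ballI impI)
  fix s t :: real assume "s \<le> t"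
  then have "- \<beta> * (t - s) \<le> m * (t - s)" "m * (t - s) \<le> \<alpha> * (t - s)"
    using assms by (intro mult_right_mono; simp)+
  then show "- \<beta> * (t - s) \<le> c + m * t - (c + m * s) \<and> c + m * t - (c + m * s) \<le> \<alpha> * (t - s)"
    by (simp add: right_diff_distrib)
qed

lemma ab_lipschitz_convex:
  assumes "ab_lipschitz \<alpha> \<beta> q g" "ab_lipschitz \<alpha> \<beta> q h" "0 \<le> a" "0 \<le> b" "a + b = 1"
  shows "ab_lipschitz \<alpha> \<beta> q (\<lambda>x. a * g x + b * h x)"
  unfolding ab_lipschitz_def
proof (intro ballI impI)
  fix s t assume st: "s \<in> horizon q" "t \<in> horizon q" "s \<le> t"
  have *: "z = a * z + b * z" for z :: real using assms(5) by (metis distrib_right mult_1)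
  have "a * (- \<beta> * (t - s)) \<le> a * (g t - g s)" "a * (g t - g s) \<le> a * (\<alpha> * (t - s))"
    "b * (- \<beta> * (t - s)) \<le> b * (h t - h s)" "b * (h t - h s) \<le> b * (\<alpha> * (t - s))"
    using assms st unfolding ab_lipschitz_def by (blast intro: mult_left_mono)+
  moreover have "a * (g t - g s) + b * (h t - h s) = a * g t + b * h t - (a * g s + b * h s)"
    by (simp add: algebra_simps)
  ultimately show "- \<beta> * (t - s) \<le> a * g t + b * h t - (a * g s + b * h s) \<and>
      a * g t + b * h t - (a * g s + b * h s) \<le> \<alpha> * (t - s)"
    using *[of "- \<beta> * (t - s)"] *[of "\<alpha> * (t - s)"] by linarith
qed

section \<open>The cost as a quadratic functional of the velocity\<close>

locale optimal_path = lipschitz_path +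
  fixes v0 d L :: real
  assumes f_measurable [measurable]: "f \<in> borel_measurable borel"
    and f_outside: "t \<notin> horizon q \<Longrightarrow> f t = 0"
    and f_integrable: "integrable lborel f"
    and f_total: "(LINT t|lborel. f t) = 1"
    and f_bounded: "bounded (range f)"
    and f_moment: "integrable lborel (\<lambda>t. t * f t)"
    and F_eq: "F t = (LINT s|lborel. indicator {..t} s * f s)"
    and optimal: "optimal_traj \<alpha> \<beta> vmax v0 d L q f v"
begin

abbreviation Om :: "real set" where "Om \<equiv> einterval 0 q"

lemma Om_subset_H: "Om \<subseteq> H"
  by (auto simp: einterval_def horizon_def zero_ereal_def)

lemma H_subset_Om: "t \<in> H \<Longrightarrow> t \<noteq> 0 \<Longrightarrow> t \<in> Om"
  by (auto simp: einterval_def horizon_def zero_ereal_def)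

lemma interval_integral_Om: "(LBINT t=0..q. g t) = (LBINT t:Om. g t)"
  using less_imp_le[OF q_pos] by (simp add: interval_lebesgue_integral_def)

lemma f_nonneg: "0 \<le> f t"
  using f_pos[of t] f_outside[of t] by (cases "t \<in> H") auto

lemma f_set_integrable: "set_integrable lborel A f" if "A \<in> sets borel"
  using that f_integrable integrable_mult_indicator[of A lborel f] by (simp add: set_integrable_def)

lemma F_measurable [measurable]: "F \<in> borel_measurable borel"
proof (rule borel_measurable_mono, rule monoI)
  fix s t :: real assume "s \<le> t"
  then show "F s \<le> F t"
    unfolding F_eq using f_set_integrable[of "{..s}"] f_set_integrable[of "{..t}"] f_nonneg
    by (intro integral_mono) (auto simp: set_integrable_def indicator_def)
qed

lemma F_complement: "1 - F t = (LINT s|lborel. indicator {t<..} s * f s)"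
proof -
  have "(LINT s|lborel. indicator {..t} s * f s) + (LINT s|lborel. indicator {t<..} s * f s)
      = (LINT s|lborel. indicator {..t} s * f s + indicator {t<..} s * f s)"
    using f_set_integrable[of "{..t}"] f_set_integrable[of "{t<..}"]
    by (subst Bochner_Integration.integral_add) (auto simp: set_integrable_def)
  also have "\<dots> = (LINT s|lborel. f s)"
    by (intro Bochner_Integration.integral_cong) (auto simp: indicator_def)
  finally show ?thesis using F_eq f_total by simp
qed

lemma F_bounds: "0 \<le> F t" "F t \<le> 1"
proof -
  show "0 \<le> F t" unfolding F_eq using f_nonneg by (intro integral_nonneg_AE) auto
  have "0 \<le> 1 - F t" unfolding F_complement using f_nonneg by (intro integral_nonneg_AE) auto
  then show "F t \<le> 1" by simp
qed

text \<open>Membership in \<open>trajs_W\<close> without the bound on the distance: the multiplier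
  argument needs competitors that travel farther than \<open>d\<close>.\<close>

definition admissible :: "(real \<Rightarrow> real) \<Rightarrow> bool" where
  "admissible w \<longleftrightarrow> ab_lipschitz \<alpha> \<beta> q w \<and> (\<forall>t \<in> H. 0 \<le> w t \<and> w t \<le> vmax) \<and> w 0 = v0 \<and>
     set_integrable lborel Om w"

lemma trajs_W_iff:
  "w \<in> trajs_W \<alpha> \<beta> vmax v0 d q \<longleftrightarrow> admissible w \<and> (LBINT t:Om. w t) \<le> d"
  using q_pos unfolding trajs_W_def admissible_def interval_lebesgue_integrable_def interval_integral_Om
  by auto

lemma v_admissible: "admissible v" and v_distance: "(LBINT t:Om. v t) = d"
  using optimal unfolding optimal_traj_def trajs_V_def trajs_W_iff interval_integral_Om by auto

lemma v_0: "v 0 = v0"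
  using v_admissible by (simp add: admissible_def)

lemma v_minimal:
  "admissible w \<Longrightarrow> (LBINT t:Om. w t) \<le> d \<Longrightarrow> cost_S \<alpha> vmax L q f v \<le> cost_S \<alpha> vmax L q f w"
  using optimal by (simp add: optimal_traj_def trajs_W_iff)

lemma admissible_bounds: "admissible w \<Longrightarrow> t \<in> Om \<Longrightarrow> 0 \<le> w t \<and> w t \<le> vmax"
  using Om_subset_H unfolding admissible_def by blast

lemma admissible_integrable: "admissible w \<Longrightarrow> integrable lborel (\<lambda>t. indicator Om t * w t)"
  unfolding admissible_def set_integrable_def by simp

lemma admissible_measurable: "admissible w \<Longrightarrow> (\<lambda>t. indicator Om t * w t) \<in> borel_measurable borel"
  using borel_measurable_integrable[OF admissible_integrable] by simp

lemma admissible_convex: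
  assumes "admissible u" "admissible w" "0 \<le> a" "0 \<le> b" "a + b = 1"
  shows "admissible (\<lambda>t. a * u t + b * w t)"
    and "(LBINT t:Om. a * u t + b * w t) = a * (LBINT t:Om. u t) + b * (LBINT t:Om. w t)"
proof -
  have int: "set_integrable lborel Om (\<lambda>t. a * u t)" "set_integrable lborel Om (\<lambda>t. b * w t)"
    using assms unfolding admissible_def by (auto intro: set_integrable_cmult)
  have bd: "0 \<le> a * u t + b * w t \<and> a * u t + b * w t \<le> vmax" if "t \<in> H" for t
  proof -
    have "0 \<le> u t" "u t \<le> vmax" "0 \<le> w t" "w t \<le> vmax"
      using assms(1,2) that unfolding admissible_def by auto
    moreover from this have "a * u t + b * w t \<le> a * vmax + b * vmax"
      using assms by (intro add_mono mult_left_mono) auto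
    moreover have "a * vmax + b * vmax = vmax" using assms(5) by (metis distrib_right mult_1)
    ultimately show ?thesis using assms(3,4) by simp
  qed
  have "a * v0 + b * v0 = v0" using assms(5) by (metis distrib_right mult_1)
  then show "admissible (\<lambda>t. a * u t + b * w t)"
    using assms bd int ab_lipschitz_convex[of \<alpha> \<beta> q u w a b] set_integral_add(1)[OF int]
    unfolding admissible_def by auto
  show "(LBINT t:Om. a * u t + b * w t) = a * (LBINT t:Om. u t) + b * (LBINT t:Om. w t)"
    using set_integral_add(2)[OF int] by simp
qed

lemma bounded_times_f:
  assumes "g \<in> borel_measurable borel" "\<And>t. \<bar>g t\<bar> \<le> C"
  shows "set_integrable lborel Om (\<lambda>t. g t * f t)"
proof -
  have "integrable lborel (\<lambda>t. g t * (indicator Om t * f t))"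
    using integrable_bounded_mult[of lborel "\<lambda>t. indicator Om t * f t" g C] assms f_set_integrable[of Om]
    by (simp add: set_integrable_def)
  then show ?thesis unfolding set_integrable_def by (simp add: mult.left_commute)
qed

lemma square_integrable:
  assumes "admissible u" "admissible w"
  shows "set_integrable lborel Om (\<lambda>t. (a + b * u t + c * w t)\<^sup>2 * f t)"
proof -
  let ?u = "\<lambda>t. indicator Om t * u t" and ?w = "\<lambda>t. indicator Om t * w t"
  note [measurable] = admissible_measurable[OF assms(1)] admissible_measurable[OF assms(2)]
  have bd: "\<bar>?u t\<bar> \<le> vmax" "\<bar>?w t\<bar> \<le> vmax" for t
    using admissible_bounds[OF assms(1), of t] admissible_bounds[OF assms(2), of t] vmax_pos
    by (auto simp: indicator_def)
  have "\<bar>(a + b * ?u t + c * ?w t)\<^sup>2\<bar> \<le> (\<bar>a\<bar> + \<bar>b\<bar> * vmax + \<bar>c\<bar> * vmax)\<^sup>2" for t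
  proof -
    have "\<bar>b * ?u t\<bar> \<le> \<bar>b\<bar> * vmax" "\<bar>c * ?w t\<bar> \<le> \<bar>c\<bar> * vmax"
      unfolding abs_mult[of b] abs_mult[of c] using bd by (intro mult_left_mono; simp)+
    then have "\<bar>a + b * ?u t + c * ?w t\<bar> \<le> \<bar>a\<bar> + \<bar>b\<bar> * vmax + \<bar>c\<bar> * vmax" by linarith
    then have "\<bar>a + b * ?u t + c * ?w t\<bar>\<^sup>2 \<le> (\<bar>a\<bar> + \<bar>b\<bar> * vmax + \<bar>c\<bar> * vmax)\<^sup>2"
      by (rule power_mono) simp
    then show ?thesis by simp
  qed
  then have "set_integrable lborel Om (\<lambda>t. (a + b * ?u t + c * ?w t)\<^sup>2 * f t)"
    by (intro bounded_times_f) measurable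
  then show ?thesis
    by (rule set_integrable_cong[THEN iffD1, rotated -1]) auto
qed

text \<open>Half the density of the first variation of the functional \<open>J\<close> at
  \<open>v\<close>.\<close>

definition lin :: "real \<Rightarrow> real" where
  "lin t = (v t - vmax) * f t - \<alpha> * (1 - F t)"

lemma times_admissible_integrable:
  assumes "admissible w" "g \<in> borel_measurable borel" "\<And>t. \<bar>g t\<bar> \<le> C"
  shows "set_integrable lborel Om (\<lambda>t. g t * w t)"
proof -
  have "integrable lborel (\<lambda>t. g t * (indicator Om t * w t))"
    using integrable_bounded_mult[of lborel "\<lambda>t. indicator Om t * w t" g C] assms admissible_integrable by simp
  then show ?thesis unfolding set_integrable_def by (simp add: mult.left_commute)
qed

text \<open>The integration by parts, done as an exchange of integrals over the region
  \<open>s < t\<close>, so that no boundary term at \<open>q\<close> arises. The inner integral of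
  \<open>f\<close> is a tail of total mass at most 1, and \<open>w\<close> is integrable, which
  justifies Fubini also for an infinite horizon.\<close>

lemma position_integral:
  assumes "admissible w"
  shows "set_integrable lborel Om (\<lambda>t. (LBINT s=0..ereal t. w s) * f t)"
    and "(LBINT t:Om. (LBINT s=0..ereal t. w s) * f t) = (LBINT t:Om. (1 - F t) * w t)"
proof -
  let ?w = "\<lambda>t. indicator Om t * w t" and ?f = "\<lambda>t. indicator Om t * f t"
  define k where "k = (\<lambda>s t. of_bool (s < t) * ?w s * ?f t)"
  note [measurable] = admissible_measurable[OF assms]
  have [measurable]: "Om \<in> sets borel" by simp
  have k_meas: "case_prod k \<in> borel_measurable (lborel \<Otimes>\<^sub>M lborel)"
    unfolding k_def by measurable
  have f1: "integrable lborel ?f" using f_set_integrable[of Om] by (simp add: set_integrable_def)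
  have w1: "integrable lborel ?w" using admissible_integrable assms by blast
  have row: "integrable lborel (\<lambda>t. k s t)" for s
    using integrable_bounded_mult[OF f1, of "\<lambda>t. of_bool (s < t) * ?w s" "\<bar>?w s\<bar>"]
    unfolding k_def by (simp add: abs_mult)
  have row_norm: "(LINT t|lborel. norm (k s t)) = (LINT t|lborel. of_bool (s < t) * ?f t) * \<bar>?w s\<bar>" for s
  proof -
    have "norm (k s t) = of_bool (s < t) * ?f t * \<bar>?w s\<bar>" for t
      using f_nonneg by (simp add: k_def abs_mult)
    then show ?thesis by simp
  qed
  have tail: "\<bar>LINT t|lborel. of_bool (s < t) * ?f t\<bar> \<le> 1" for s
  proof -
    have "0 \<le> (LINT t|lborel. of_bool (s < t) * ?f t)"
      using f_nonneg by (intro integral_nonneg_AE) auto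
    moreover have "(LINT t|lborel. of_bool (s < t) * ?f t) \<le> (LINT t|lborel. f t)"
      using integrable_bounded_mult[OF f1, of "\<lambda>t. of_bool (s < t)" 1] f_integrable f_nonneg
      by (intro integral_mono) (auto simp: indicator_def)
    ultimately show ?thesis using f_total by simp
  qed
  have k_int: "integrable (lborel \<Otimes>\<^sub>M lborel) (case_prod k)"
  proof (rule lborel_pair.Fubini_integrable[OF k_meas])
    have "integrable lborel (\<lambda>s. (LINT t|lborel. of_bool (s < t) * ?f t) * \<bar>?w s\<bar>)"
      using tail by (intro integrable_bounded_mult[of _ _ _ 1] integrable_abs w1) measurable
    then show "integrable lborel (\<lambda>s. LINT t|lborel. norm (case_prod k (s, t)))"
      using row_norm by simp
    show "AE s in lborel. integrable lborel (\<lambda>t. case_prod k (s, t))" using row by simp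
  qed
  have pos: "(LINT s|lborel. k s t) = indicator Om t * ((LBINT s=0..ereal t. w s) * f t)" for t
  proof (cases "t \<in> Om")
    case True
    then have t: "0 \<le> ereal t" "ereal t < q" by (auto simp: einterval_def)
    have "(LBINT s=0..ereal t. w s) = (LINT s|lborel. of_bool (s < t) * ?w s)"
      unfolding interval_lebesgue_integral_def set_lebesgue_integral_def using t
      by (auto intro!: Bochner_Integration.integral_cong simp: einterval_def indicator_def)
        (metis less_ereal.simps(1) less_trans)
    then show ?thesis using True by (simp add: k_def)
  qed (simp add: k_def)
  have "integrable lborel (\<lambda>t. LINT s|lborel. k s t)" using lborel_pair.integrable_snd[OF k_int] .
  then show "set_integrable lborel Om (\<lambda>t. (LBINT s=0..ereal t. w s) * f t)"
    unfolding pos set_integrable_def by simp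
  have "(LBINT t:Om. (LBINT s=0..ereal t. w s) * f t) = (LINT t|lborel. LINT s|lborel. k s t)"
    unfolding pos set_lebesgue_integral_def by simp
  also have "\<dots> = (LINT s|lborel. LINT t|lborel. k s t)"
    by (rule lborel_pair.Fubini_integral[OF k_int])
  also have "\<dots> = (LBINT s:Om. (1 - F s) * w s)"
    unfolding set_lebesgue_integral_def
  proof (intro Bochner_Integration.integral_cong refl)
    fix s :: real
    have "(LINT t|lborel. k s t) = ?w s * (LINT t|lborel. of_bool (s < t) * ?f t)"
      unfolding k_def by (subst integral_mult_right_zero[symmetric]) (simp add: mult_ac)
    also have "\<dots> = ?w s * (1 - F s)"
    proof (cases "s \<in> Om")
      case True
      then have "0 < s" by (simp add: einterval_def)
      then have "of_bool (s < t) * ?f t = indicator {s<..} t * f t" for t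
        using f_outside[of t] H_subset_Om[of t] by (cases "t \<in> H") (auto simp: indicator_def)
      then show ?thesis by (simp only: F_complement)
    qed simp
    finally show "(LINT t|lborel. k s t) = indicator Om s *\<^sub>R ((1 - F s) * w s)" by simp
  qed
  finally show "(LBINT t:Om. (LBINT s=0..ereal t. w s) * f t) = (LBINT t:Om. (1 - F t) * w t)" .
qed

text \<open>The part of the cost that depends on the trajectory, scaled by
  \<open>2 * \<alpha> * vmax\<close>. The second integral is the position term.\<close>

definition J :: "(real \<Rightarrow> real) \<Rightarrow> real" where
  "J w = (LBINT t:Om. (vmax - w t)\<^sup>2 * f t) - 2 * \<alpha> * (LBINT t:Om. (1 - F t) * w t)"

lemma cost_eq_J:
  assumes "admissible w"
  shows "cost_S \<alpha> vmax L q f w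
    = (LBINT t:Om. t * f t) + L / vmax * (LBINT t:Om. f t) + 1 / (2 * \<alpha> * vmax) * J w"
proof -
  let ?x = "\<lambda>t. LBINT s=0..ereal t. w s"
  have i1: "set_integrable lborel Om (\<lambda>t. t * f t)"
    using integrable_mult_indicator[OF _ f_moment, of Om] by (simp add: set_integrable_def)
  have i2: "set_integrable lborel Om (\<lambda>t. L / vmax * f t)"
    using f_set_integrable[of Om] by (intro set_integrable_cmult) simp
  have i3: "set_integrable lborel Om (\<lambda>t. 1 / (2 * \<alpha> * vmax) * ((vmax - w t)\<^sup>2 * f t))"
    using square_integrable[OF assms assms, of vmax "-1" 0] by (intro set_integrable_cmult) simp
  have i4: "set_integrable lborel Om (\<lambda>t. 1 / vmax * (?x t * f t))"
    using position_integral(1)[OF assms] by (intro set_integrable_cmult)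
  have "(t + time_to_go \<alpha> vmax L x y) * f t
     = t * f t + L / vmax * f t + 1 / (2 * \<alpha> * vmax) * ((vmax - y)\<^sup>2 * f t) - 1 / vmax * (x * f t)" for t x y
    unfolding time_to_go_def using vmax_pos by (simp add: field_simps)
  then have "cost_S \<alpha> vmax L q f w = (LBINT t:Om. t * f t + L / vmax * f t
      + 1 / (2 * \<alpha> * vmax) * ((vmax - w t)\<^sup>2 * f t) - 1 / vmax * (?x t * f t))"
    unfolding cost_S_def interval_integral_Om by simp
  also have "\<dots> = (LBINT t:Om. t * f t) + L / vmax * (LBINT t:Om. f t)
      + 1 / (2 * \<alpha> * vmax) * (LBINT t:Om. (vmax - w t)\<^sup>2 * f t) - 1 / vmax * (LBINT t:Om. ?x t * f t)"
    using i1 i2 i3 i4 by (simp only: set_integral_diff set_integral_add set_integral_mult_right)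
  also have "\<dots> = (LBINT t:Om. t * f t) + L / vmax * (LBINT t:Om. f t) + 1 / (2 * \<alpha> * vmax) * J w"
    unfolding J_def position_integral(2)[OF assms] using \<alpha>_pos vmax_pos by (simp add: field_simps)
  finally show ?thesis .
qed

lemma lin_integrable: "admissible w \<Longrightarrow> set_integrable lborel Om (\<lambda>t. lin t * w t)"
proof -
  assume w: "admissible w"
  obtain K where K: "\<And>t. f t \<le> K" "0 \<le> K"
    using f_bounded by (metis abs_ge_self abs_ge_zero bounded_iff order_trans range_eqI real_norm_def)
  let ?g = "\<lambda>t. (indicator Om t * v t - vmax) * f t - \<alpha> * (1 - F t)"
  note [measurable] = admissible_measurable[OF v_admissible]
  have "\<bar>?g t\<bar> \<le> vmax * K + \<alpha>" for t
  proof -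
    have "\<bar>indicator Om t * v t - vmax\<bar> \<le> vmax"
      using admissible_bounds[OF v_admissible, of t] vmax_pos by (auto simp: indicator_def)
    then have "\<bar>(indicator Om t * v t - vmax) * f t\<bar> \<le> vmax * K"
      using K f_nonneg[of t] vmax_pos unfolding abs_mult by (intro mult_mono) auto
    moreover have "\<bar>\<alpha> * (1 - F t)\<bar> \<le> \<alpha>"
      using F_bounds[of t] \<alpha>_pos by (simp add: abs_mult mult_le_cancel_left1)
    ultimately show ?thesis by linarith
  qed
  then have "set_integrable lborel Om (\<lambda>t. ?g t * w t)"
    by (intro times_admissible_integrable[OF w]) measurable
  then show ?thesis
    by (rule set_integrable_cong[THEN iffD1, rotated -1]) (auto simp: lin_def)
qed

lemma lin_diff_integrable:
  assumes "admissible w"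
  shows "set_integrable lborel Om (\<lambda>t. lin t * (w t - v t))"
    and "set_integrable lborel Om (\<lambda>t. w t - v t)"
  using set_integral_diff(1)[OF lin_integrable[OF assms] lin_integrable[OF v_admissible]] assms v_admissible
  by (auto simp: right_diff_distrib admissible_def)

text \<open>The functional is quadratic, so the expansion along a segment is exact and no remainder
  has to be estimated.\<close>

lemma J_expand:
  assumes "admissible u"
  shows "J (\<lambda>t. (1 - \<epsilon>) * v t + \<epsilon> * u t) = J v + 2 * \<epsilon> * (LBINT t:Om. lin t * (u t - v t))
     + \<epsilon>\<^sup>2 * (LBINT t:Om. (u t - v t)\<^sup>2 * f t)"
proof -
  let ?h = "\<lambda>t. u t - v t" and ?w = "\<lambda>t. (1 - \<epsilon>) * v t + \<epsilon> * u t"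
  have i1: "set_integrable lborel Om (\<lambda>t. (vmax - v t)\<^sup>2 * f t)"
    using square_integrable[OF v_admissible v_admissible, of vmax "-1" 0] by simp
  have i2: "set_integrable lborel Om (\<lambda>t. \<epsilon>\<^sup>2 * ((?h t)\<^sup>2 * f t))"
    using square_integrable[OF v_admissible assms, of 0 "-1" 1] by (intro set_integrable_cmult) simp
  have i3: "set_integrable lborel Om (\<lambda>t. 2 * \<epsilon> * (lin t * ?h t))"
    using lin_diff_integrable(1)[OF assms] by (intro set_integrable_cmult)
  have F: "set_integrable lborel Om (\<lambda>t. (1 - F t) * w t)" if "admissible w" for w
    using F_bounds by (intro times_admissible_integrable[OF that, of _ 1]) auto
  have i4: "set_integrable lborel Om (\<lambda>t. 2 * \<alpha> * \<epsilon> * ((1 - F t) * u t - (1 - F t) * v t))"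
    using F[OF assms] F[OF v_admissible] by (intro set_integrable_cmult set_integral_diff)
  have "(LBINT t:Om. (vmax - ?w t)\<^sup>2 * f t)
     = (LBINT t:Om. (vmax - v t)\<^sup>2 * f t + 2 * \<epsilon> * (lin t * ?h t)
        + 2 * \<alpha> * \<epsilon> * ((1 - F t) * u t - (1 - F t) * v t) + \<epsilon>\<^sup>2 * ((?h t)\<^sup>2 * f t))"
    by (intro set_lebesgue_integral_cong)
      (auto simp: lin_def algebra_simps power2_eq_square)
  also have "\<dots> = (LBINT t:Om. (vmax - v t)\<^sup>2 * f t) + 2 * \<epsilon> * (LBINT t:Om. lin t * ?h t)
       + 2 * \<alpha> * \<epsilon> * ((LBINT t:Om. (1 - F t) * u t) - (LBINT t:Om. (1 - F t) * v t))
       + \<epsilon>\<^sup>2 * (LBINT t:Om. (?h t)\<^sup>2 * f t)"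
    using i1 i2 i3 i4 F[OF assms] F[OF v_admissible]
    by (simp only: set_integral_add set_integral_mult_right set_integral_diff set_integrable_cmult)
  finally have sq: "(LBINT t:Om. (vmax - ?w t)\<^sup>2 * f t)
     = (LBINT t:Om. (vmax - v t)\<^sup>2 * f t) + 2 * \<epsilon> * (LBINT t:Om. lin t * ?h t)
       + 2 * \<alpha> * \<epsilon> * ((LBINT t:Om. (1 - F t) * u t) - (LBINT t:Om. (1 - F t) * v t))
       + \<epsilon>\<^sup>2 * (LBINT t:Om. (?h t)\<^sup>2 * f t)" .
  have "(LBINT t:Om. (1 - F t) * ?w t) = (LBINT t:Om. (1 - \<epsilon>) * ((1 - F t) * v t) + \<epsilon> * ((1 - F t) * u t))"
    by (simp add: algebra_simps)
  also have "\<dots> = (1 - \<epsilon>) * (LBINT t:Om. (1 - F t) * v t) + \<epsilon> * (LBINT t:Om. (1 - F t) * u t)"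
    using F[OF assms] F[OF v_admissible] by (simp only: set_integral_add set_integral_mult_right set_integrable_cmult)
  finally have tail: "(LBINT t:Om. (1 - F t) * ?w t)
      = (1 - \<epsilon>) * (LBINT t:Om. (1 - F t) * v t) + \<epsilon> * (LBINT t:Om. (1 - F t) * u t)" .
  show ?thesis unfolding J_def sq tail by (simp add: algebra_simps)
qed

text \<open>Both ends of the segment from \<open>v\<close> to \<open>u\<close> have distance
  \<open>d\<close>, so the whole segment is feasible and the cost cannot drop below its value at
  \<open>v\<close>.\<close>

lemma variational_inequality:
  assumes "admissible u" "(LBINT t:Om. u t) = d"
  shows "0 \<le> (LBINT t:Om. lin t * (u t - v t))"
proof (rule nonneg_from_quadratic)
  fix \<epsilon> :: real assume e: "0 < \<epsilon>" "\<epsilon> \<le> 1"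
  let ?w = "\<lambda>t. (1 - \<epsilon>) * v t + \<epsilon> * u t"
  have w: "admissible ?w" "(LBINT t:Om. ?w t) = d"
    using admissible_convex[OF v_admissible assms(1), of "1 - \<epsilon>" \<epsilon>] e assms(2) v_distance
    by (auto simp: algebra_simps)
  have "1 / (2 * \<alpha> * vmax) * J v \<le> 1 / (2 * \<alpha> * vmax) * J ?w"
    using v_minimal[OF w(1)] w(2) cost_eq_J[OF w(1)] cost_eq_J[OF v_admissible] by simp
  then have "J v \<le> J ?w" using \<alpha>_pos vmax_pos by (simp add: mult_le_cancel_left_pos divide_le_cancel)
  then show "0 \<le> 2 * \<epsilon> * (LBINT t:Om. lin t * (u t - v t)) + \<epsilon>\<^sup>2 * (LBINT t:Om. (u t - v t)\<^sup>2 * f t)"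
    using J_expand[OF assms(1), of \<epsilon>] by simp
qed

text \<open>Change of distance and first variation are affine in \<open>w\<close>, so their pairs
  form a convex set in the plane. The trajectories \<open>u1\<close> and \<open>u2\<close> put
  points of it on both sides of the vertical axis, which yields a finite multiplier.\<close>

lemma multiplier:
  assumes "admissible u1" "(LBINT t:Om. u1 t) > d" "admissible u2" "(LBINT t:Om. u2 t) < d"
  obtains B where "\<And>w. admissible w \<Longrightarrow> 0 \<le> (LBINT t:Om. (v t - E B t) * f t * (w t - v t))"
proof -
  let ?S = "(\<lambda>w. (LBINT t:Om. w t - v t, LBINT t:Om. lin t * (w t - v t))) ` Collect admissible"
  have diff: "(LBINT t:Om. w t - v t) = (LBINT t:Om. w t) - d" if "admissible w" for w
    using that v_admissible v_distance unfolding admissible_def by (simp add: set_integral_diff)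
  have conv: "convex ?S"
  proof (rule convexI)
    fix x y :: "real \<times> real" and a b :: real
    assume "x \<in> ?S" "y \<in> ?S" and ab: "0 \<le> a" "0 \<le> b" "a + b = 1"
    then obtain u w where u: "admissible u" "x = (LBINT t:Om. u t - v t, LBINT t:Om. lin t * (u t - v t))"
      and w: "admissible w" "y = (LBINT t:Om. w t - v t, LBINT t:Om. lin t * (w t - v t))" by auto
    let ?m = "\<lambda>t. a * u t + b * w t"
    have m: "?m t - v t = a * (u t - v t) + b * (w t - v t)" for t
    proof -
      have "v t = a * v t + b * v t" using ab(3) by (metis distrib_right mult_1)
      then show ?thesis by (simp add: right_diff_distrib)
    qed
    have "(LBINT t:Om. ?m t - v t) = a * (LBINT t:Om. u t - v t) + b * (LBINT t:Om. w t - v t)"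
      unfolding m using lin_diff_integrable(2) u w
      by (simp only: set_integral_add set_integral_mult_right set_integrable_cmult)
    moreover have "(LBINT t:Om. lin t * (?m t - v t))
      = a * (LBINT t:Om. lin t * (u t - v t)) + b * (LBINT t:Om. lin t * (w t - v t))"
    proof -
      have "lin t * (?m t - v t) = a * (lin t * (u t - v t)) + b * (lin t * (w t - v t))" for t
        unfolding m by (simp add: algebra_simps)
      then show ?thesis using lin_diff_integrable(1) u w
        by (simp only: set_integral_add set_integral_mult_right set_integrable_cmult)
    qed
    moreover have "admissible ?m" using admissible_convex u w ab by blast
    ultimately show "a *\<^sub>R x + b *\<^sub>R y \<in> ?S"
      unfolding u(2) w(2) by (intro image_eqI[of _ _ ?m]) auto
  qed
  have zero: "0 \<le> b" if "(0, b) \<in> ?S" for b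
    using that variational_inequality diff by auto
  have in1: "((LBINT t:Om. u1 t - v t), (LBINT t:Om. lin t * (u1 t - v t))) \<in> ?S" using assms by auto
  have in2: "((LBINT t:Om. u2 t - v t), (LBINT t:Om. lin t * (u2 t - v t))) \<in> ?S" using assms by auto
  have sgn: "0 < (LBINT t:Om. u1 t - v t)" "(LBINT t:Om. u2 t - v t) < 0" using diff assms by auto
  obtain \<mu> where \<mu>: "\<And>a b. (a, b) \<in> ?S \<Longrightarrow> 0 \<le> b + \<mu> * a"
    using lagrange_multiplier[OF conv zero in1 sgn(1) in2 sgn(2)] by blast
  show thesis
  \<comment> \<open>Adding \<open>\<mu>\<close> to \<open>lin t\<close> gives
    \<open>(v t - vmax) * f t + (\<mu> - \<alpha>) + \<alpha> * F t\<close>, which is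
    \<open>f t\<close> times the distance of \<open>v t\<close> from the curve with this
    parameter.\<close>
  proof (rule that[of "\<mu> - \<alpha>"])
    fix w assume w: "admissible w"
    have "0 \<le> (LBINT t:Om. lin t * (w t - v t)) + \<mu> * (LBINT t:Om. w t - v t)"
      using \<mu> w by auto
    also have "\<dots> = (LBINT t:Om. lin t * (w t - v t) + \<mu> * (w t - v t))"
      using lin_diff_integrable[OF w] by (simp only: set_integral_add set_integral_mult_right set_integrable_cmult)
    also have "\<dots> = (LBINT t:Om. (v t - E (\<mu> - \<alpha>) t) * f t * (w t - v t))"
    proof (intro set_lebesgue_integral_cong allI impI)
      fix t assume "t \<in> Om"
      then have "f t \<noteq> 0" using f_pos[of t] Om_subset_H by auto
      then have "(v t - E (\<mu> - \<alpha>) t) * f t = lin t + \<mu>"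
        by (simp add: lin_def EL_curve_def field_simps)
      then show "lin t * (w t - v t) + \<mu> * (w t - v t) = (v t - E (\<mu> - \<alpha>) t) * f t * (w t - v t)"
        by (simp add: distrib_right)
    qed simp
    finally show "0 \<le> (LBINT t:Om. (v t - E (\<mu> - \<alpha>) t) * f t * (w t - v t))" .
  qed
qed

end

section \<open>Structure of optimal trajectories\<close>

context optimal_path
begin

section \<open>From the integral inequality to pointwise comparison\<close>

lemma gradient_integrable:
  assumes "admissible w"
  shows "set_integrable lborel Om (\<lambda>t. (v t - E B t) * f t * (w t - v t))"
proof -
  have "set_integrable lborel Om (\<lambda>t. lin t * (w t - v t) + (B + \<alpha>) * (w t - v t))"
    using lin_diff_integrable[OF assms] by (intro set_integral_add(1) set_integrable_cmult)
  moreover have "lin t * (w t - v t) + (B + \<alpha>) * (w t - v t) = (v t - E B t) * f t * (w t - v t)"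
    if "t \<in> Om" for t
  proof -
    have "f t \<noteq> 0" using f_pos[of t] Om_subset_H that by auto
    then have "lin t + (B + \<alpha>) = (v t - E B t) * f t"
      by (simp add: lin_def EL_curve_def field_simps)
    then show ?thesis by (metis distrib_right)
  qed
  ultimately show ?thesis
    by (subst (asm) set_integrable_cong[OF refl refl]) auto
qed

lemma admissible_eqI:
  assumes "admissible w" "AE x in lborel. x \<in> Om \<longrightarrow> w x = v x" "x \<in> H"
  shows "w x = v x"
proof (cases "x = 0")
  case True
  then show ?thesis using assms(1) v_admissible by (simp add: admissible_def)
next
  case False
  have "continuous_on Om w" "continuous_on Om v"
    using assms(1) v_admissible Om_subset_H ab_lipschitz_continuous_on continuous_on_subset
    unfolding admissible_def by blast+
  then show ?thesis
    using AE_eq_continuous_on_open[of Om w v x] assms H_subset_Om[OF _ False] by auto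
qed

text \<open>The integrand is nonpositive, and negative wherever \<open>w\<close> exceeds
  \<open>v\<close>. Since its integral is nonnegative it vanishes almost everywhere, and continuity
  does the rest.\<close>

lemma raise_test:
  assumes VI: "0 \<le> (LBINT t:Om. (v t - E B t) * f t * (w t - v t))"
    and w: "admissible w" and ge: "\<And>x. x \<in> H \<Longrightarrow> v x \<le> w x"
    and below: "\<And>x. x \<in> H \<Longrightarrow> v x < w x \<Longrightarrow> v x < E B x"
    and "x \<in> H"
  shows "w x = v x"
proof (rule admissible_eqI[OF w _ \<open>x \<in> H\<close>])
  define \<psi> where "\<psi> = (\<lambda>t. (-1) * ((v t - E B t) * f t * (w t - v t)))"
  have sign: "v t < w t \<Longrightarrow> 0 < \<psi> t" "0 \<le> \<psi> t" if "t \<in> Om" for t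
  proof -
    have tH: "t \<in> H" using that Om_subset_H by auto
    show pos: "0 < \<psi> t" if "v t < w t"
      using below[OF tH that] f_pos[OF tH] that by (simp add: \<psi>_def mult_less_0_iff)
    show "0 \<le> \<psi> t" using pos ge[OF tH] by (cases "v t = w t") (auto simp: \<psi>_def)
  qed
  have "AE t in lborel. t \<in> Om \<longrightarrow> \<psi> t = 0"
  proof (rule set_integral_nonpos_eq_0)
    show "set_integrable lborel Om \<psi>"
      unfolding \<psi>_def by (intro set_integrable_cmult gradient_integrable w)
    show "(LBINT t:Om. \<psi> t) \<le> 0" using VI unfolding \<psi>_def set_integral_mult_right by simp
  qed (use sign in auto)
  then show "AE x in lborel. x \<in> Om \<longrightarrow> w x = v x"
  proof eventually_elim
    case (elim t)
    show ?case
    proof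
      assume "t \<in> Om"
      then show "w t = v t" using elim sign(1)[of t] ge[of t] Om_subset_H by force
    qed
  qed
qed

lemma lower_test:
  assumes VI: "0 \<le> (LBINT t:Om. (v t - E B t) * f t * (w t - v t))"
    and w: "admissible w" and le: "\<And>x. x \<in> H \<Longrightarrow> w x \<le> v x"
    and above: "\<And>x. x \<in> H \<Longrightarrow> w x < v x \<Longrightarrow> E B x < v x"
    and "x \<in> H"
  shows "w x = v x"
proof (rule admissible_eqI[OF w _ \<open>x \<in> H\<close>])
  define \<psi> where "\<psi> = (\<lambda>t. (-1) * ((v t - E B t) * f t * (w t - v t)))"
  have sign: "w t < v t \<Longrightarrow> 0 < \<psi> t" "0 \<le> \<psi> t" if "t \<in> Om" for t
  proof -
    have tH: "t \<in> H" using that Om_subset_H by auto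
    show pos: "0 < \<psi> t" if "w t < v t"
      using above[OF tH that] f_pos[OF tH] that by (simp add: \<psi>_def mult_less_0_iff)
    show "0 \<le> \<psi> t" using pos le[OF tH] by (cases "v t = w t") (auto simp: \<psi>_def)
  qed
  have "AE t in lborel. t \<in> Om \<longrightarrow> \<psi> t = 0"
  proof (rule set_integral_nonpos_eq_0)
    show "set_integrable lborel Om \<psi>"
      unfolding \<psi>_def by (intro set_integrable_cmult gradient_integrable w)
    show "(LBINT t:Om. \<psi> t) \<le> 0" using VI unfolding \<psi>_def set_integral_mult_right by simp
  qed (use sign in auto)
  then show "AE x in lborel. x \<in> Om \<longrightarrow> w x = v x"
  proof eventually_elim
    case (elim t)
    show ?case
    proof
      assume "t \<in> Om"
      then show "w t = v t" using elim sign(1)[of t] le[of t] Om_subset_H by force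
    qed
  qed
qed

lemma set_borel_measurable_lipschitz:
  assumes "ab_lipschitz \<alpha> \<beta> q w"
  shows "set_borel_measurable lborel Om w"
proof -
  have "continuous_on Om w"
    using ab_lipschitz_continuous_on[OF assms] Om_subset_H continuous_on_subset by blast
  then have "(\<lambda>x. indicator Om x *\<^sub>R w x) \<in> borel_measurable borel"
    by (intro borel_measurable_continuous_on_indicator) auto
  then show ?thesis by (simp add: set_borel_measurable_def)
qed

lemma ab_lipschitz_lines:
  "ab_lipschitz \<alpha> \<beta> q (\<lambda>x. c + \<alpha> * (x - s))" "ab_lipschitz \<alpha> \<beta> q (\<lambda>x. c - \<beta> * (x - s))"
  "ab_lipschitz \<alpha> \<beta> q (\<lambda>x. c - \<alpha> * (s - x))" "ab_lipschitz \<alpha> \<beta> q (\<lambda>x. c + \<beta> * (s - x))"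
  "ab_lipschitz \<alpha> \<beta> q (\<lambda>x. c)"
  using ab_lipschitz_affine[of \<beta> \<alpha> \<alpha> q "c - \<alpha> * s"] ab_lipschitz_affine[of \<beta> "-\<beta>" \<alpha> q "c + \<beta> * s"]
    ab_lipschitz_affine[of \<beta> 0 \<alpha> q c] \<alpha>_pos \<beta>_pos
  by (simp_all add: algebra_simps)

lemma tent_admissible:
  assumes "s \<in> H"
  shows "admissible (\<lambda>x. max (v x) (min (v s + \<alpha> * (x - s)) (min vmax (y + \<beta> * (u - x)))))"
    (is "admissible ?w")
  unfolding admissible_def
proof (intro conjI ballI)
  show lip: "ab_lipschitz \<alpha> \<beta> q ?w"
    by (intro ab_lipschitz_max ab_lipschitz_min v_lipschitz ab_lipschitz_lines)
  show "0 \<le> ?w t" "?w t \<le> vmax" if "t \<in> H" for t using v_nonneg v_le that by (auto simp: le_max_iff_disj)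
  have "v s \<le> v 0 + \<alpha> * s" using v_upper[OF zero_in_H assms] assms by (simp add: horizon_def)
  then show "?w 0 = v0" using v_0 by (auto simp: max_def)
  \<comment> \<open>The time after which the falling side is nonpositive. From then on the
    competitor equals \<open>v\<close>, so it is integrable even on an infinite horizon.\<close>
  define R where "R = max 0 (u + y / \<beta>)"
  have i1: "integrable lborel (\<lambda>t. indicator Om t * v t + vmax * indicator {0..R} t)"
    using admissible_integrable[OF v_admissible] by (intro Bochner_Integration.integrable_add integrable_mult_right integrable_real_indicator)
      (auto simp: R_def)
  show "set_integrable lborel Om ?w"
    unfolding set_integrable_def
  proof (rule Bochner_Integration.integrable_bound[OF i1])
    show "(\<lambda>x. indicator Om x *\<^sub>R ?w x) \<in> borel_measurable lborel"
      using set_borel_measurable_lipschitz[OF lip] by (simp add: set_borel_measurable_def)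
    have "norm (indicator Om t *\<^sub>R ?w t) \<le> norm (indicator Om t * v t + vmax * indicator {0..R} t)" for t
    proof (cases "t \<in> Om")
      case True
      then have t: "t \<in> H" "0 < t" using Om_subset_H by (auto simp: einterval_def)
      have v: "0 \<le> v t" using v_nonneg t by auto
      have "?w t \<le> v t + vmax * indicator {0..R} t"
      proof (cases "t \<le> R")
        case True
        then show ?thesis using t v vmax_pos by auto
      next
        case False
        then have "y / \<beta> < t - u" unfolding R_def by linarith
        then have "y < (t - u) * \<beta>" using \<beta>_pos by (simp only: pos_divide_less_eq)
        then have "y + \<beta> * (u - t) \<le> 0" by (simp add: algebra_simps)
        then show ?thesis using False v by auto
      qed
      then show ?thesis using True v vmax_pos by (auto simp: le_max_iff_disj)
    qed (use vmax_pos in auto)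
    then show "AE t in lborel. norm (indicator Om t *\<^sub>R ?w t) \<le> norm (indicator Om t * v t + vmax * indicator {0..R} t)"
      by simp
  qed
qed

lemma valley_admissible:
  assumes "s \<in> H"
  shows "admissible (\<lambda>x. min (v x) (max (v s - \<beta> * (x - s)) (max 0 (y - \<alpha> * (u - x)))))"
    (is "admissible ?w")
  unfolding admissible_def
proof (intro conjI ballI)
  show lip: "ab_lipschitz \<alpha> \<beta> q ?w"
    by (intro ab_lipschitz_max ab_lipschitz_min v_lipschitz ab_lipschitz_lines)
  show bd: "0 \<le> ?w t" "?w t \<le> vmax" if "t \<in> H" for t
    using v_nonneg[OF that] v_le[OF that] by (auto simp: min_le_iff_disj)
  have "v 0 \<le> v s + \<beta> * s" using v_lower[OF zero_in_H assms] assms by (simp add: horizon_def)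
  then show "?w 0 = v0" using v_0 by (auto simp: min_def)
  show "set_integrable lborel Om ?w"
  \<comment> \<open>The competitor lies between 0 and \<open>v\<close>, so \<open>v\<close> itself
    dominates it.\<close>
  proof (rule set_integrable_bound)
    show "set_integrable lborel Om v" using v_admissible by (simp add: admissible_def)
    show "set_borel_measurable lborel Om ?w" by (rule set_borel_measurable_lipschitz[OF lip])
    have "norm (?w t) \<le> norm (v t)" if "t \<in> Om" for t
      using bd(1)[of t] v_nonneg[of t] that Om_subset_H by auto
    then show "AE t in lborel. t \<in> Om \<longrightarrow> norm (?w t) \<le> norm (v t)" by auto
  qed
qed

lemma el_path_of_VI:
  assumes VI: "\<And>w. admissible w \<Longrightarrow> 0 \<le> (LBINT t:Om. (v t - E B t) * f t * (w t - v t))"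
  shows "el_path \<alpha> \<beta> vmax q f F v B"
proof unfold_locales
  fix s u y x
  assume s: "s \<in> H" and x: "x \<in> H"
  show "min (v s + \<alpha> * (x - s)) (min vmax (y + \<beta> * (u - x))) \<le> v x"
    if below: "\<And>x. x \<in> H \<Longrightarrow> s < x \<Longrightarrow> v x < y + \<beta> * (u - x) \<Longrightarrow> v x < E B x"
  proof -
    let ?w = "\<lambda>x. max (v x) (min (v s + \<alpha> * (x - s)) (min vmax (y + \<beta> * (u - x))))"
    have "?w x = v x"
    proof (rule raise_test[OF VI[OF tent_admissible[OF s]] tent_admissible[OF s] _ _ x])
      fix z assume z: "z \<in> H" "v z < ?w z"
      then have *: "v z < v s + \<alpha> * (z - s)" "v z < y + \<beta> * (u - z)" by auto
      have "s < z"
      proof (rule ccontr)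
        assume "\<not> s < z"
        then show False using v_upper[of z s] z s * by (simp add: algebra_simps)
      qed
      then show "v z < E B z" using below z * by blast
    qed simp
    then show ?thesis by linarith
  qed
  show "v x \<le> max (v s - \<beta> * (x - s)) (max 0 (y - \<alpha> * (u - x)))"
    if above: "\<And>x. x \<in> H \<Longrightarrow> s < x \<Longrightarrow> y - \<alpha> * (u - x) < v x \<Longrightarrow> E B x < v x"
  proof -
    let ?w = "\<lambda>x. min (v x) (max (v s - \<beta> * (x - s)) (max 0 (y - \<alpha> * (u - x))))"
    have "?w x = v x"
    proof (rule lower_test[OF VI[OF valley_admissible[OF s]] valley_admissible[OF s] _ _ x])
      fix z assume z: "z \<in> H" "?w z < v z"
      then have *: "v s - \<beta> * (z - s) < v z" "y - \<alpha> * (u - z) < v z" by auto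
      have "s < z"
      proof (rule ccontr)
        assume "\<not> s < z"
        then show False using v_lower[of z s] z s * by (simp add: algebra_simps)
      qed
      then show "E B z < v z" using above z * by blast
    qed simp
    then show ?thesis by linarith
  qed
qed

text \<open>One of the two functions is \<open>v\<close> because equality almost everywhere is made
  pointwise through \<open>admissible_eqI\<close>, which compares with \<open>v\<close>.\<close>

lemma admissible_less:
  assumes "admissible u" "admissible w" "\<And>x. x \<in> H \<Longrightarrow> u x \<le> w x" "u = v \<or> w = v" "x \<in> H" "u x \<noteq> w x"
  shows "(LBINT t:Om. u t) < (LBINT t:Om. w t)"
proof (rule ccontr)
  assume not_less: "\<not> ?thesis"
  have int: "set_integrable lborel Om u" "set_integrable lborel Om w" using assms by (auto simp: admissible_def)
  have "AE t in lborel. t \<in> Om \<longrightarrow> w t - u t = 0"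
  proof (rule set_integral_nonpos_eq_0)
    show "set_integrable lborel Om (\<lambda>t. w t - u t)" using int by (rule set_integral_diff(1)[rotated])
    show "(LBINT t:Om. w t - u t) \<le> 0" using not_less int by (simp add: set_integral_diff)
  qed (use assms(3) Om_subset_H in auto)
  then have "AE t in lborel. t \<in> Om \<longrightarrow> u t = w t" by eventually_elim auto
  then show False
    using assms(4-6) admissible_eqI[OF assms(1) _ assms(5)] admissible_eqI[OF assms(2) _ assms(5)]
    by (auto elim!: AE_mp simp: eq_commute)
qed

lemma optimal_structure:
  "weak_covers 0 [Accel, Cruise, EL, Decel, Halt] \<and>
     (EL_never_steep \<longrightarrow> weak_covers 0 [Accel, Cruise, EL, Halt]) \<or>
   weak_covers 0 [Decel, EL, Decel, Halt] \<and>
     (EL_never_steep \<longrightarrow> weak_covers 0 [Decel, EL, Halt] \<or> weak_covers 0 [Decel, Halt])"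
proof -
  consider (slowest) "\<And>x. x \<in> H \<Longrightarrow> v x = max (v 0 - \<beta> * x) 0"
    | (fastest) "\<And>x. x \<in> H \<Longrightarrow> v x = min (v 0 + \<alpha> * x) vmax"
    | (other) x1 x2 where "x1 \<in> H" "v x1 \<noteq> min (v 0 + \<alpha> * x1) vmax"
      "x2 \<in> H" "v x2 \<noteq> max (v 0 - \<beta> * x2) 0" by blast
  then show ?thesis
  proof cases
    case slowest
    have "weak_covers (ereal 0) [Decel, Halt]"
    proof (rule braking_covers(1)[OF zero_in_H])
      show "v x = max (v 0 - \<beta> * (x - 0)) 0" if "x \<in> H" for x
        using slowest[OF that] unfolding diff_zero .
    qed
    then have "weak_covers 0 [Decel, Halt]" by (simp only: zero_ereal_def)
    moreover from this have "weak_covers 0 [Decel, EL, Decel, Halt]"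
      using weak_covers_skip by blast
    ultimately show ?thesis by blast
  next
    case fastest
    have *: "weak_covers 0 (Accel # Cruise # ps)" if "weak_covers q ps" for ps
    proof (rule accel_cruise_covers[OF _ _ _ that])
      show "v x = min (v 0 + \<alpha> * x) vmax" if "x \<in> seg 0 q" for x
        using fastest[of x] that unfolding segment_def by blast
    qed (use q_pos in auto)
    have "weak_covers q [EL, Decel, Halt]" "weak_covers q [EL, Halt]" by auto
    then show ?thesis using * by blast
  next
    case (other x1 x2)
    \<comment> \<open>Fastest driving up to \<open>x1\<close>, then a descent that keeps the
      distance finite: this exceeds \<open>v\<close> at \<open>x1\<close>, where \<open>v\<close> is
      not the fastest trajectory. Dually, \<open>?u2\<close> is below \<open>v\<close> at
      \<open>x2\<close>.\<close>
    let ?u1 = "\<lambda>x. max (v x) (min (v 0 + \<alpha> * (x - 0)) (min vmax (vmax + \<beta> * (x1 - x))))"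
    let ?u2 = "\<lambda>x. min (v x) (max (v 0 - \<beta> * (x - 0)) (max 0 (0 - \<alpha> * (x2 - x))))"
    have u1: "admissible ?u1" and u2: "admissible ?u2"
      by (rule tent_admissible[OF zero_in_H], rule valley_admissible[OF zero_in_H])
    have nonneg: "0 \<le> x1" "0 \<le> x2" using other(1,3) by (auto simp: horizon_def)
    have "d < (LBINT t:Om. ?u1 t)"
      unfolding v_distance[symmetric]
    proof (rule admissible_less[OF v_admissible u1])
      show "x1 \<in> H" by (rule other)
      show "v x1 \<noteq> ?u1 x1"
        using other(2) v_upper[OF zero_in_H other(1) nonneg(1)] v_le[OF other(1)] by auto
    qed auto
    moreover have "(LBINT t:Om. ?u2 t) < d"
      unfolding v_distance[symmetric]
    proof (rule admissible_less[OF u2 v_admissible])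
      show "x2 \<in> H" by (rule other)
      show "?u2 x2 \<noteq> v x2"
        using other(4) v_lower[OF zero_in_H other(3) nonneg(2)] v_nonneg[OF other(3)] by auto
    qed auto
    ultimately obtain B where "\<And>w. admissible w \<Longrightarrow> 0 \<le> (LBINT t:Om. (v t - E B t) * f t * (w t - v t))"
      using multiplier[OF u1 _ u2] by blast
    then interpret el_path \<alpha> \<beta> vmax q f F v B by (rule el_path_of_VI)
    show ?thesis by (rule path_structure)
  qed
qed

section \<open>Listing the phases and excluding impossible endings\<close>

lemma v_nonzero:
  assumes "0 < d"
  shows "\<exists>t \<in> H. v t \<noteq> 0"
proof (rule ccontr)
  assume "\<not> ?thesis"
  then have "(LBINT t:Om. v t) = (LBINT t:Om. 0)"
    using Om_subset_H by (intro set_lebesgue_integral_cong) auto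
  then show False using assms v_distance by (simp add: set_lebesgue_integral_def)
qed

lemma tail_not_integrable:
  fixes g :: "real \<Rightarrow> real"
  assumes "q = \<infinity>" "set_integrable lborel Om g" "0 < c" "0 \<le> r"
    "\<And>t. r < t \<Longrightarrow> c \<le> g t" "\<And>t. 0 < t \<Longrightarrow> 0 \<le> g t"
  shows False
proof -
  have "c * real n \<le> (LBINT t:Om. g t)" for n
  proof -
    have "c * real n = (LINT t|lborel. c * indicator {r<..r + real n} t)" by simp
    also have "\<dots> \<le> (LINT t|lborel. indicator Om t *\<^sub>R g t)"
    proof (rule integral_mono)
      show "integrable lborel (\<lambda>t. c * indicator {r<..r + real n} t)" by simp
      show "integrable lborel (\<lambda>t. indicator Om t *\<^sub>R g t)" using assms(2) by (simp add: set_integrable_def)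
      show "c * indicator {r<..r + real n} t \<le> indicator Om t *\<^sub>R g t" for t
        using assms(1,4,6) assms(5)[of t] by (auto simp: indicator_def einterval_def)
    qed
    finally show ?thesis by (simp add: set_lebesgue_integral_def)
  qed
  moreover obtain n where "(LBINT t:Om. g t) / c < real n" using reals_Archimedean2 by blast
  ultimately show False using assms(3) by (metis mult.commute not_le pos_divide_less_eq)
qed

text \<open>The last piece is unbounded. Accelerating would exceed \<open>vmax\<close>, braking
  would become negative, and cruising would cover infinite distance. Following a curve at
  nonnegative velocity would bound \<open>f\<close> below by a positive constant on a half-line,
  against its integrability.\<close>

lemma infinite_horizon_halts:
  assumes "q = \<infinity>" "0 \<le> a" "covers a (ps @ [p])"
  shows "p = Halt"
proof -
  obtain b where b: "a \<le> b" "covers b [p]" using covers_append assms by blast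
  have "0 \<le> b" using order_trans[OF assms(2) b(1)] .
  have "b < q" "typed (seg b q) p" using b(2) by simp_all
  obtain r where r: "b = ereal r" "r \<in> H" using horizon_real_of_ereal[OF \<open>0 \<le> b\<close> \<open>b < q\<close>] .
  have r0: "0 \<le> r" using r by (simp add: horizon_def)
  have inH: "t \<in> H" if "0 \<le> t" for t using that assms(1) by (simp add: horizon_def)
  have seg: "t \<in> seg b q" if "r \<le> t" for t using that r0 r inH[of t] assms(1) by (simp add: segment_def)
  show ?thesis
  proof (cases p)
    case Accel
    then obtain c where "\<forall>t\<in>seg b q. v t = c + \<alpha> * t" using \<open>typed (seg b q) p\<close> by auto
    then have c: "\<And>t. r \<le> t \<Longrightarrow> v t = c + \<alpha> * t" using seg by blast
    define t where "t = max r ((vmax + 1 - c) / \<alpha>)"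
    have "vmax + 1 - c \<le> \<alpha> * t" using \<alpha>_pos by (simp add: t_def field_simps max_def)
    moreover have "r \<le> t" by (simp add: t_def)
    ultimately show ?thesis using c[of t] v_le[OF inH, of t] r0 by simp
  next
    case Decel
    then obtain c where "\<forall>t\<in>seg b q. v t = c - \<beta> * t" using \<open>typed (seg b q) p\<close> by auto
    then have c: "\<And>t. r \<le> t \<Longrightarrow> v t = c - \<beta> * t" using seg by blast
    define t where "t = max r ((c + 1) / \<beta>)"
    have "c + 1 \<le> \<beta> * t" using \<beta>_pos by (simp add: t_def field_simps max_def)
    moreover have "r \<le> t" by (simp add: t_def)
    ultimately show ?thesis using c[of t] v_nonneg[OF inH, of t] r0 by simp
  next
    case Cruise
    then have "\<And>t. r \<le> t \<Longrightarrow> v t = vmax" using \<open>typed (seg b q) p\<close> seg by auto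
    then show ?thesis
      using tail_not_integrable[OF assms(1) _ vmax_pos r0, of v] v_admissible v_nonneg inH
      by (auto simp: admissible_def)
  next
    case EL
    then obtain B where "\<forall>t\<in>seg b q. v t = E B t" using \<open>typed (seg b q) p\<close> by auto
    then have B: "\<And>t. r \<le> t \<Longrightarrow> v t = E B t" using seg by blast
    have nn: "0 \<le> B + \<alpha> * F r"
      using B[of r] v_le[OF r(2)] f_pos[OF r(2)] by (simp add: EL_curve_alt zero_le_divide_iff)
    \<comment> \<open>At \<open>r\<close> the numerator may still be 0; one unit later the strict
      growth of \<open>F\<close> makes it positive.\<close>
    define c where "c = (B + \<alpha> * F (r + 1)) / vmax"
    have "F r < F (r + 1)" using F_strict_mono inH r0 by (auto simp: monotone_on_def)
    then have "\<alpha> * F r < \<alpha> * F (r + 1)" using \<alpha>_pos by simp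
    then have "0 < c" using nn vmax_pos unfolding c_def by (intro divide_pos_pos) auto
    have "c \<le> f t" if "r + 1 < t" for t
    proof -
      have tH: "t \<in> H" using inH that r0 by simp
      have "F (r + 1) < F t" using F_strict_mono inH r0 that by (auto simp: monotone_on_def)
      then have "\<alpha> * F (r + 1) \<le> \<alpha> * F t" using \<alpha>_pos by simp
      moreover have "(B + \<alpha> * F t) / f t \<le> vmax"
        using B[of t] v_nonneg[OF tH] that by (simp add: EL_curve_alt)
      then have "B + \<alpha> * F t \<le> vmax * f t" using f_pos[OF tH] by (simp add: pos_divide_le_eq)
      ultimately show ?thesis using vmax_pos unfolding c_def by (simp add: pos_divide_le_eq mult.commute)
    qed
    then show ?thesis
      using tail_not_integrable[OF assms(1) _ \<open>0 < c\<close>, of f "r + 1"] f_set_integrable[of Om] f_nonneg r0 by auto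
  qed
qed

lemma canonical_phases:
  assumes "0 < d"
  obtains ps pos where "covers 0 ps" "distinct_adj ps" "pos \<in> unstarred_orders \<union> starred_orders"
    "ps = pos \<or> ps = pos @ [Halt]" "EL_never_steep \<Longrightarrow> pos \<in> unstarred_orders"
proof -
  have cov: "\<exists>ps \<in> remdups_adj ` set (List.subseqs ts). covers 0 ps \<and> distinct_adj ps \<and> ps \<noteq> [] \<and> ps \<noteq> [Halt]"
    if ts: "weak_covers 0 ts" for ts
  proof -
    obtain ps where ps: "ps \<in> set (List.subseqs ts)" "covers 0 ps" using weak_covers_subseq[OF ts] by blast
    then have c: "covers 0 (remdups_adj ps)" by (intro covers_remdups_adj) auto
    moreover have "remdups_adj ps \<noteq> []" using c q_pos by auto
    moreover have "remdups_adj ps \<noteq> [Halt]"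
    proof
      assume "remdups_adj ps = [Halt]"
      then have "\<forall>t \<in> seg 0 q. v t = 0" using c by auto
      moreover have "H \<subseteq> seg 0 q" by (auto simp: segment_def horizon_def zero_ereal_def)
      ultimately show False using v_nonzero[OF assms] by blast
    qed
    ultimately show ?thesis using ps by auto
  qed
  \<comment> \<open>The list of orders is obtained by evaluation: all subsequences of the two words
    are enumerated, repetitions are merged, and the empty list and the lone halt are discarded, the
    latter because \<open>d\<close> is positive.\<close>
  have orders: "\<exists>pos \<in> unstarred_orders \<union> starred_orders. ps = pos \<or> ps = pos @ [Halt]"
    if "ps \<in> remdups_adj ` set (List.subseqs [Accel, Cruise, EL, Decel, Halt])
        \<union> remdups_adj ` set (List.subseqs [Decel, EL, Decel, Halt])" "ps \<noteq> []" "ps \<noteq> [Halt]" for ps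
    using that unfolding starred_orders_def unstarred_orders_def by (simp add: Let_def) (elim disjE; simp)
  have flat_orders: "\<exists>pos \<in> unstarred_orders. ps = pos \<or> ps = pos @ [Halt]"
    if "ps \<in> remdups_adj ` set (List.subseqs [Accel, Cruise, EL, Halt])
        \<union> remdups_adj ` set (List.subseqs [Decel, EL, Halt]) \<union> remdups_adj ` set (List.subseqs [Decel, Halt])"
      "ps \<noteq> []" "ps \<noteq> [Halt]" for ps
    using that unfolding unstarred_orders_def by (simp add: Let_def) (elim disjE; simp)
  show thesis
  proof (cases EL_never_steep)
    case True
    then have "weak_covers 0 [Accel, Cruise, EL, Halt] \<or> weak_covers 0 [Decel, EL, Halt] \<or> weak_covers 0 [Decel, Halt]"
      using optimal_structure by blast
    then obtain ps where ps: "ps \<in> remdups_adj ` set (List.subseqs [Accel, Cruise, EL, Halt])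
        \<union> remdups_adj ` set (List.subseqs [Decel, EL, Halt]) \<union> remdups_adj ` set (List.subseqs [Decel, Halt])"
      "ps \<noteq> []" "ps \<noteq> [Halt]" "covers 0 ps" "distinct_adj ps"
      using cov by blast
    from flat_orders[OF ps(1-3)] ps(4,5) that show thesis by blast
  next
    case False
    have "weak_covers 0 [Accel, Cruise, EL, Decel, Halt] \<or> weak_covers 0 [Decel, EL, Decel, Halt]"
      using optimal_structure by blast
    then obtain ps where ps: "ps \<in> remdups_adj ` set (List.subseqs [Accel, Cruise, EL, Decel, Halt])
        \<union> remdups_adj ` set (List.subseqs [Decel, EL, Decel, Halt])"
      "ps \<noteq> []" "ps \<noteq> [Halt]" "covers 0 ps" "distinct_adj ps"
      using cov by blast
    from orders[OF ps(1-3)] ps(4,5) that False show thesis by blast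
  qed
qed

lemma phases_of_optimal:
  assumes "0 < d"
  shows "(\<exists>ps. phase_sequence \<alpha> \<beta> vmax q f F v ps) \<and>
         (\<forall>ps. phase_sequence \<alpha> \<beta> vmax q f F v ps \<longrightarrow>
            (\<exists>pos \<in> unstarred_orders \<union> starred_orders.
               (ps = pos \<or> ps = pos @ [Halt]) \<and>
               (EL_never_steep \<longrightarrow> pos \<notin> starred_orders) \<and>
               (q = \<infinity> \<longrightarrow> pos \<notin> {[Accel], [Accel, Cruise], [Cruise]} \<and> ps = pos @ [Halt]) \<and>
               (q < \<infinity> \<and> ps = pos @ [Halt] \<longrightarrow> last pos \<notin> {Accel, Cruise})))"
proof -
  obtain qs pos where qs: "covers 0 qs" "distinct_adj qs" "pos \<in> unstarred_orders \<union> starred_orders"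
    "qs = pos \<or> qs = pos @ [Halt]" "EL_never_steep \<Longrightarrow> pos \<in> unstarred_orders"
    using canonical_phases[OF assms] by metis
  have disjoint: "unstarred_orders \<inter> starred_orders = {}"
    by (simp add: unstarred_orders_def starred_orders_def)
  have pos: "pos \<noteq> []" "last pos \<noteq> Halt"
    using qs(3) by (auto simp: unstarred_orders_def starred_orders_def)
  have last: "last pos \<notin> {Accel, Cruise}" if "qs = pos @ [Halt]"
  proof -
    have "qs = butlast pos @ [last pos, Halt]" using that pos(1) by simp
    then show ?thesis using covers_before_halt[of 0 "butlast pos" "last pos"] qs(1) by auto
  qed
  have inf: "qs = pos @ [Halt]" if "q = \<infinity>"
  proof -
    have "qs \<noteq> []" using qs(4) pos(1) by auto
    then have "last qs = Halt"
      using infinite_horizon_halts[OF that, of 0 "butlast qs" "last qs"] qs(1) by simp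
    then show ?thesis using qs(4) pos(2) by auto
  qed
  show ?thesis
  proof (intro conjI allI impI)
    show "\<exists>ps. phase_sequence \<alpha> \<beta> vmax q f F v ps" using covers_phase_sequence qs by blast
    fix ps assume "phase_sequence \<alpha> \<beta> vmax q f F v ps"
    \<comment> \<open>Every phase sequence is a covering without adjacent repetitions, so what is
      known about \<open>qs\<close> holds for it.\<close>
    then have "ps = qs"
      using covers_unique[of 0 ps qs] phase_sequence_covers[of ps] qs by simp
    then show "\<exists>pos \<in> unstarred_orders \<union> starred_orders.
               (ps = pos \<or> ps = pos @ [Halt]) \<and>
               (EL_never_steep \<longrightarrow> pos \<notin> starred_orders) \<and>
               (q = \<infinity> \<longrightarrow> pos \<notin> {[Accel], [Accel, Cruise], [Cruise]} \<and> ps = pos @ [Halt]) \<and>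
               (q < \<infinity> \<and> ps = pos @ [Halt] \<longrightarrow> last pos \<notin> {Accel, Cruise})"
      using qs(3,4,5) disjoint last inf by (intro bexI[of _ pos]) auto
  qed
qed

end

section \<open>The distribution function and the main theorem\<close>

lemma cdf_density:
  assumes "distributed M lborel T (\<lambda>t. ennreal (f t))" "\<And>t. 0 \<le> f t"
  shows "cdf (distr M borel T) t = (LINT s|lborel. indicator {..t} s * f s)"
proof -
  have T: "T \<in> borel_measurable M" using distributed_measurable[OF assms(1)] by simp
  have "cdf (distr M borel T) t = measure M (T -` {..t} \<inter> space M)"
    using T by (simp add: cdf_def measure_distr)
  also have "\<dots> = (LINT \<omega>|M. indicator {..t} (T \<omega>))"
  proof -
    have "(LINT \<omega>|M. indicator {..t} (T \<omega>)) = (LINT \<omega>|M. indicator (T -` {..t} \<inter> space M) \<omega> :: real)"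
      by (intro Bochner_Integration.integral_cong) (auto simp: indicator_def)
    then show ?thesis by simp
  qed
  also have "\<dots> = (LINT s|lborel. f s * indicator {..t} s)"
    using distributed_integral[OF assms(1), of "indicator {..t}"] assms(2) by simp
  finally show ?thesis by (simp add: mult.commute)
qed

lemma primitive_strict_mono_on:
  fixes f :: "real \<Rightarrow> real"
  assumes "integrable lborel f" "\<And>t. 0 \<le> f t" "antimono_on (horizon q) f" "\<And>t. t \<in> horizon q \<Longrightarrow> 0 < f t"
  shows "strict_mono_on (horizon q) (\<lambda>t. LINT s|lborel. indicator {..t} s * f s)"
proof (rule strict_mono_onI)
  fix s t assume st: "s \<in> horizon q" "t \<in> horizon q" "s < t"
  have int: "integrable lborel (\<lambda>s. indicator {..x} s * f s)" for x
    using integrable_mult_indicator[OF _ assms(1), of "{..x}"] by simp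
  \<comment> \<open>On \<open>{s<..t}\<close> the density is at least \<open>f t\<close>, its value
    at the right end, so the primitive grows by at least \<open>f t * (t - s)\<close>.\<close>
  have bound: "indicator {..s} x * f x + f t * indicator {s<..t} x \<le> indicator {..t} x * f x" for x
  proof (cases "x \<in> {s<..t}")
    case True
    then have "x \<in> horizon q" using horizon_Icc_subset[OF st(1,2)] by auto
    then have "f t \<le> f x" using assms(3) st True by (auto simp: monotone_on_def)
    then show ?thesis using True by auto
  qed (use st assms(2) in \<open>auto simp: indicator_def\<close>)
  have "(LINT x|lborel. indicator {..s} x * f x) < (LINT x|lborel. indicator {..s} x * f x) + f t * (t - s)"
    using assms(4)[OF st(2)] st(3) by simp
  also have "\<dots> = (LINT x|lborel. indicator {..s} x * f x + f t * indicator {s<..t} x)"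
    using int st(3) by (subst Bochner_Integration.integral_add) auto
  also have "\<dots> \<le> (LINT x|lborel. indicator {..t} x * f x)"
    using int bound st(3) by (intro integral_mono) (auto intro!: Bochner_Integration.integrable_add integrable_mult_right integrable_real_indicator)
  finally show "(LINT x|lborel. indicator {..s} x * f x) < (LINT x|lborel. indicator {..t} x * f x)" .
qed

lemma primitive_differentiable_on:
  fixes f :: "real \<Rightarrow> real"
  assumes "integrable lborel f" "continuous_on (horizon q) f" "\<And>t. t \<notin> horizon q \<Longrightarrow> f t = 0"
  shows "(\<lambda>t. LINT s|lborel. indicator {..t} s * f s) differentiable_on (horizon q)"
  unfolding differentiable_on_def
proof
  fix t assume t: "t \<in> horizon q"
  \<comment> \<open>The fundamental theorem is applied on the compact interval
    \<open>{0..b}\<close>. Since \<open>b\<close> lies strictly beyond \<open>t\<close>, being near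
    \<open>t\<close> within \<open>{0..b}\<close> and within the horizon mean the same, including
    one-sidedly at 0.\<close>
  obtain b where b: "t < b" "ereal b < q"
    using t ereal_dense2[of "ereal t" q] by (auto simp: horizon_def)
  have bH: "b \<in> horizon q" using b t by (auto simp: horizon_def)
  have zero: "0 \<in> horizon q" using t le_less_trans[of "ereal 0" "ereal t" q] by (auto simp: horizon_def)
  have eq: "(LINT s|lborel. indicator {..x} s * f s) = integral {0..x} f" for x
  proof -
    have "(LINT s|lborel. indicator {..x} s * f s) = (LINT s:{0..x}|lborel. f s)"
      unfolding set_lebesgue_integral_def using assms(3)
      by (intro Bochner_Integration.integral_cong) (auto simp: indicator_def horizon_def)
    also have "\<dots> = integral {0..x} f"
      using integrable_mult_indicator[OF _ assms(1), of "{0..x}"]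
      by (intro set_borel_integral_eq_integral) (auto simp: set_integrable_def)
    finally show ?thesis .
  qed
  have "((\<lambda>x. integral {0..x} f) has_vector_derivative f t) (at t within {0..b})"
    using continuous_on_subset[OF assms(2) horizon_Icc_subset[OF zero bH]] t b
    by (intro integral_has_vector_derivative) (auto simp: horizon_def)
  moreover have "at t within {0..b} = at t within (horizon q)"
  proof (rule at_within_nhd)
    show "{0..b} \<inter> {..<b} - {t} = horizon q \<inter> {..<b} - {t}"
      using b(2) by (auto simp: horizon_def intro: less_trans[of "ereal _" "ereal b" q])
  qed (use b in auto)
  ultimately show "(\<lambda>t. LINT s|lborel. indicator {..t} s * f s) differentiable at t within horizon q"
    unfolding eq using vector_derivative_works differentiableI_vector by metis
qed

theorem theorem4p2:
  fixes M :: "'a measure" and T :: "'a \<Rightarrow> real" and f F :: "real \<Rightarrow> real"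
    and \<alpha> \<beta> vmax v0 d L :: real and q :: ereal and v :: "real \<Rightarrow> real"
  assumes "0 < \<alpha>" and "0 < \<beta>" and "0 < vmax" and "0 \<le> v0" and "v0 \<le> vmax" and "0 < d"
    and "vmax\<^sup>2 / (2 * \<alpha>) \<le> L" and "0 < q"
    and "prob_space M"
    and "AE \<omega> in M. 0 \<le> T \<omega>"
    and "integrable M T"
    and "distributed M lborel T (\<lambda>t. ennreal (f t))"
    and "\<And>t. t \<notin> horizon q \<Longrightarrow> f t = 0"
    and "bounded (range f)"
    and "\<And>t. t \<in> horizon q \<Longrightarrow> 0 < f t"
    and "antimono_on (horizon q) f"
    and "f differentiable_on horizon q"
    and "F = cdf (distr M borel T)"
    and d_ge1: "ereal (v0 / \<beta>) \<le> q \<Longrightarrow> v0\<^sup>2 / (2 * \<beta>) \<le> d"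
    and d_ge2: "q < ereal (v0 / \<beta>) \<Longrightarrow>
                  real_of_ereal q * (v0 - real_of_ereal q * \<beta> / 2) \<le> d"
    and d_less1: "q \<le> ereal ((vmax - v0) / \<alpha>) \<Longrightarrow>
                  d < real_of_ereal q * (v0 + real_of_ereal q * \<alpha> / 2)"
    and d_less2: "ereal ((vmax - v0) / \<alpha>) \<le> q \<Longrightarrow>
                  ereal d < ereal ((vmax - v0) * (vmax + v0) / (2 * \<alpha>))
                            + ereal vmax * (q - ereal ((vmax - v0) / \<alpha>))"
    and EL_sign: "\<And>B. (\<forall>t \<in> horizon q. 0 < EL_slope \<alpha> vmax q f F B t + \<beta>) \<or>
                      (\<forall>t \<in> horizon q. EL_slope \<alpha> vmax q f F B t + \<beta> < 0) \<or>
                      (\<exists>t0. 0 < t0 \<and> ereal t0 < q \<and>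
                         (\<forall>t \<in> horizon q. t < t0 \<longrightarrow> 0 < EL_slope \<alpha> vmax q f F B t + \<beta>) \<and>
                         (\<forall>t \<in> horizon q. t0 < t \<longrightarrow> EL_slope \<alpha> vmax q f F B t + \<beta> < 0))"
    and opt: "optimal_traj \<alpha> \<beta> vmax v0 d L q f v"
  shows "(\<exists>ps. phase_sequence \<alpha> \<beta> vmax q f F v ps) \<and>
         (\<forall>ps. phase_sequence \<alpha> \<beta> vmax q f F v ps \<longrightarrow>
            (\<exists>pos \<in> unstarred_orders \<union> starred_orders.
               (ps = pos \<or> ps = pos @ [Halt]) \<and>
               ((\<forall>B. \<forall>t \<in> horizon q. 0 < EL_curve \<alpha> vmax f F B t \<longrightarrow>
                    - \<beta> \<le> EL_slope \<alpha> vmax q f F B t) \<longrightarrow> pos \<notin> starred_orders) \<and>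
               (q = \<infinity> \<longrightarrow> pos \<notin> {[Accel], [Accel, Cruise], [Cruise]} \<and> ps = pos @ [Halt]) \<and>
               (q < \<infinity> \<and> ps = pos @ [Halt] \<longrightarrow> last pos \<notin> {Accel, Cruise})))"
proof -
  interpret prob_space M by fact
  have f_nonneg: "0 \<le> f t" for t
    using assms(13,15)[of t] by (cases "t \<in> horizon q") auto
  have f_meas: "f \<in> borel_measurable borel"
    using distributed_real_measurable[OF _ assms(12)] f_nonneg by simp
  have f_int: "integrable lborel f"
    using distributed_integrable[OF assms(12), of "\<lambda>_. 1 :: real"] f_nonneg by simp
  have f_total: "(LINT t|lborel. f t) = 1"
    using distributed_integral[OF assms(12), of "\<lambda>_. 1 :: real"] f_nonneg by (simp add: prob_space)
  have f_moment: "integrable lborel (\<lambda>t. t * f t)"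
    using distributed_integrable[OF assms(12), of "\<lambda>t. t"] f_nonneg assms(11) by (simp add: mult.commute)
  have F_eq: "F t = (LINT s|lborel. indicator {..t} s * f s)" for t
    using cdf_density[OF assms(12)] f_nonneg assms(18) by simp
  have F_mono: "strict_mono_on (horizon q) F"
    using primitive_strict_mono_on[OF f_int f_nonneg assms(16,15)] unfolding F_eq[symmetric] .
  have F_diff: "F differentiable_on horizon q"
    using primitive_differentiable_on[OF f_int differentiable_imp_continuous_on[OF assms(17)] assms(13)]
    unfolding F_eq[symmetric] .
  have v: "ab_lipschitz \<alpha> \<beta> q v" "\<And>t. t \<in> horizon q \<Longrightarrow> 0 \<le> v t" "\<And>t. t \<in> horizon q \<Longrightarrow> v t \<le> vmax"
    using opt unfolding optimal_traj_def trajs_V_def trajs_W_def by auto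
  interpret optimal_path \<alpha> \<beta> vmax q f F v v0 d L
    by unfold_locales
      (use assms(1-3,8,13-17) EL_sign opt v f_meas f_int f_total f_moment F_eq F_mono F_diff in blast)+
  show ?thesis using phases_of_optimal[OF assms(6)] unfolding EL_never_steep_def .
qed

end
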